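(* Let $\mathcal{G}$ be an ultragraph and $R$ a unital commutative ring. The representations $\pi:L_R(\mathcal{G})\rightarrow \mathrm{End}_R(\mathbb{P})$ and $\varphi:L_R(\mathcal{G})\rightarrow \mathrm{End}_R(M(\mathfrak{p}^*\cup\mathfrak{p}^\infty))$ (both defined in the context) are equivalent.
   Context: An ultragraph is a quadruple $\mathcal{G}=(G^0,\mathcal{G}^1,r,s)$ where $G^0,\mathcal{G}^1$ are countable sets, $s:\mathcal{G}^1\to G^0$ and $r:\mathcal{G}^1\to P(G^0)\setminus\{\emptyset\}$ are maps. $\mathcal{G}^0$ is the smallest subset of $P(G^0)$ containing $\{v\}$ for all $v\in G^0$ and $r(e)$ for all $e\in\mathcal{G}^1$, and closed under finite unions and non-empty finite intersections. A vertex $v$ is a sink if $s^{-1}(v)=\emptyset$; $G^0_s$ is the set of sinks. $L_R(\mathcal{G})$ is the universal (not necessarily unital) $R$-algebra with generators $\{s_e,s_e^*:e\in\mathcal{G}^1\}\cup\{p_A:A\in\mathcal{G}^0\}$ and relations: (1) $p_\emptyset=0$, $p_Ap_B=p_{A\cap B}$, $p_{A\cup B}=p_A+p_B-p_{A\cap B}$ for all $A,B\in\mathcal{G}^0$; (2) $p_{s(e)}s_e=s_ep_{r(e)}=s_e$ and $p_{r(e)}s_e^*=s_e^*p_{s(e)}=s_e^*$ for each $e$; (3) $s_e^*s_f=\delta_{e,f}p_{r(e)}$ for all $e,f$; (4) $p_v=\sum_{s(e)=v}s_es_e^*$ whenever $0<|s^{-1}(v)|<\infty$ (where $p_v=p_{\{v\}}$).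 A representation on an $R$-module $M$ is an $R$-algebra homomorphism $L_R(\mathcal{G})\to \mathrm{End}_R(M)$. Representations $\pi:L_R(\mathcal{G})\to \mathrm{End}_R(M)$ and $\varphi:L_R(\mathcal{G})\to \mathrm{End}_R(N)$ are equivalent if there is an $R$-module isomorphism $U:M\to N$ with $U\circ\pi(a)=\varphi(a)\circ U$ for each $a\in L_R(\mathcal{G})$. A finite path of length $n\ge1$ is a sequence of edges $\alpha=e_1\dots e_n$ with $s(e_{i+1})\in r(e_i)$ for $1\le i\le n-1$; $s(\alpha)=s(e_1)$, $r(\alpha)=r(e_n)$. An infinite path is a sequence $e_1e_2e_3\dots$ of edges with $s(e_{i+1})\in r(e_i)$ for all $i\ge1$, with source $s(e_1)$. $\mathfrak{p}^\infty$ is the set of infinite paths, and $\mathfrak{p}^*=\{(\alpha,v):\alpha \text{ a finite path of length}\ge1,\ v\in r(\alpha)\cap G^0_s\}\cup\{(v,v):v\in G^0_s\}$, with $s(\alpha,v)=s(\alpha)$ and $s(v,v)=v$. $\mathbb{P}$ is the free $R$-module with basis $\{b_\alpha:\alpha\in\mathfrak{p}^*\cup\mathfrak{p}^\infty\}$. For a statement $q$, $[q]=1$ if $q$ is true and $0$ otherwise. $\pi:L_R(\mathcal{G})\to \mathrm{End}_R(\mathbb{P})$ is the representation with $\pi(p_A)(b_\alpha)=[s(\alpha)\in A]b_\alpha$, $\pi(s_e)(b_\alpha)=[s(\alpha)\in r(e)]b_{e\alpha}$, $\pi(s_e^* )(b_\alpha)=[\alpha_1=e]b_{\alpha_2\alpha_3\dots}$.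 Here, for $\alpha=(a,v)\in\mathfrak{p}^*$ with $|a|\ge1$, $e\alpha=(ea,v)$, $\alpha_1=a_1$, and $b_{\alpha_2\alpha_3\dots}$ means $b_{(a_2\dots a_{|a|},v)}$ if $|a|\ge2$ and $b_{(v,v)}$ if $|a|=1$; for $\alpha=(v,v)$ with $v\in r(e)$, $e\alpha=(e,v)$; and $\pi(s_e^* )(b_{(v,v)})=0$. For $A\in\mathcal{G}^0$ let $B_A=\{x\in\mathfrak{p}^*\cup\mathfrak{p}^\infty:s(x)\in A\}$; for $e\in\mathcal{G}^1$ let $L_e=\{x\in\mathfrak{p}^*\cup\mathfrak{p}^\infty:x_1=e\}$ and let $f_e:B_{r(e)}\to L_e$ be the bijection $f_e(x)=ex$. $M(\mathfrak{p}^*\cup\mathfrak{p}^\infty)$ is the $R$-module of all maps from $\mathfrak{p}^*\cup\mathfrak{p}^\infty$ to $R$ with finite support. $\varphi:L_R(\mathcal{G})\to \mathrm{End}_R(M(\mathfrak{p}^*\cup\mathfrak{p}^\infty))$ is the representation with $\varphi(p_A)(\phi)=\chi_{B_A}\cdot\phi$, $\varphi(s_e)(\phi)=\chi_{L_e}\cdot(\phi\circ f_e^{-1})$, $\varphi(s_e^* )(\phi)=\chi_{B_{r(e)}}\cdot(\phi\circ f_e)$, where $\chi_Z$ is the characteristic map of $Z$ and products are extended by $0$ outside $L_e$, respectively $B_{r(e)}$. *)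

theory Defs
  imports "HOL-Algebra.Module" "HOL-Library.Countable_Set" "HOL-Library.Stream"
begin

section \<open>Algebras over a commutative ring\<close>

text \<open>Associative, not necessarily unital algebras are represented by the record of
  HOL-Algebra modules. The \<open>one\<close> field of that record plays no role for algebras, and
  neither \<open>one\<close> nor \<open>mult\<close> does for modules.\<close>

locale nonunital_algebra = module R A for R (structure) and A (structure) +
  assumes m_closed: "\<lbrakk>x \<in> carrier A; y \<in> carrier A\<rbrakk> \<Longrightarrow> x \<otimes>\<^bsub>A\<^esub> y \<in> carrier A"
    and m_assoc: "\<lbrakk>x \<in> carrier A; y \<in> carrier A; z \<in> carrier A\<rbrakk> \<Longrightarrow>
      (x \<otimes>\<^bsub>A\<^esub> y) \<otimes>\<^bsub>A\<^esub> z = x \<otimes>\<^bsub>A\<^esub> (y \<otimes>\<^bsub>A\<^esub> z)"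
    and l_distr: "\<lbrakk>x \<in> carrier A; y \<in> carrier A; z \<in> carrier A\<rbrakk> \<Longrightarrow>
      (x \<oplus>\<^bsub>A\<^esub> y) \<otimes>\<^bsub>A\<^esub> z = x \<otimes>\<^bsub>A\<^esub> z \<oplus>\<^bsub>A\<^esub> y \<otimes>\<^bsub>A\<^esub> z"
    and r_distr: "\<lbrakk>x \<in> carrier A; y \<in> carrier A; z \<in> carrier A\<rbrakk> \<Longrightarrow>
      x \<otimes>\<^bsub>A\<^esub> (y \<oplus>\<^bsub>A\<^esub> z) = x \<otimes>\<^bsub>A\<^esub> y \<oplus>\<^bsub>A\<^esub> x \<otimes>\<^bsub>A\<^esub> z"
    and smult_assoc_l: "\<lbrakk>a \<in> carrier R; x \<in> carrier A; y \<in> carrier A\<rbrakk> \<Longrightarrow>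
      (a \<odot>\<^bsub>A\<^esub> x) \<otimes>\<^bsub>A\<^esub> y = a \<odot>\<^bsub>A\<^esub> (x \<otimes>\<^bsub>A\<^esub> y)"
    and smult_assoc_r: "\<lbrakk>a \<in> carrier R; x \<in> carrier A; y \<in> carrier A\<rbrakk> \<Longrightarrow>
      x \<otimes>\<^bsub>A\<^esub> (a \<odot>\<^bsub>A\<^esub> y) = a \<odot>\<^bsub>A\<^esub> (x \<otimes>\<^bsub>A\<^esub> y)"

text \<open>Homomorphisms are extensional functions on the carrier of their domain, so that
  equality of homomorphisms is equality of functions.\<close>

definition mod_hom ::
  "('r, 'c) ring_scheme \<Rightarrow> ('r, 'm, 'd) module_scheme \<Rightarrow> ('r, 'n, 'k) module_scheme \<Rightarrow> ('m \<Rightarrow> 'n) set"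
  where "mod_hom R M N = {f \<in> carrier M \<rightarrow>\<^sub>E carrier N.
    (\<forall>x\<in>carrier M. \<forall>y\<in>carrier M. f (x \<oplus>\<^bsub>M\<^esub> y) = f x \<oplus>\<^bsub>N\<^esub> f y) \<and>
    (\<forall>a\<in>carrier R. \<forall>x\<in>carrier M. f (a \<odot>\<^bsub>M\<^esub> x) = a \<odot>\<^bsub>N\<^esub> f x)}"

definition mod_iso ::
  "('r, 'c) ring_scheme \<Rightarrow> ('r, 'm, 'd) module_scheme \<Rightarrow> ('r, 'n, 'k) module_scheme \<Rightarrow> ('m \<Rightarrow> 'n) set"
  where "mod_iso R M N = {f \<in> mod_hom R M N. bij_betw f (carrier M) (carrier N)}"

definition alg_hom ::
  "('r, 'c) ring_scheme \<Rightarrow> ('r, 'm, 'd) module_scheme \<Rightarrow> ('r, 'n, 'k) module_scheme \<Rightarrow> ('m \<Rightarrow> 'n) set"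
  where "alg_hom R A B = {f \<in> mod_hom R A B.
    \<forall>x\<in>carrier A. \<forall>y\<in>carrier A. f (x \<otimes>\<^bsub>A\<^esub> y) = f x \<otimes>\<^bsub>B\<^esub> f y}"

definition End_alg ::
  "('r, 'c) ring_scheme \<Rightarrow> ('r, 'm, 'd) module_scheme \<Rightarrow> ('r, 'm \<Rightarrow> 'm) module"
  where "End_alg R M =
    \<lparr>carrier = mod_hom R M M,
     monoid.mult = (\<lambda>f g. compose (carrier M) f g),
     one = (\<lambda>x\<in>carrier M. x),
     zero = (\<lambda>x\<in>carrier M. \<zero>\<^bsub>M\<^esub>),
     add = (\<lambda>f g. \<lambda>x\<in>carrier M. f x \<oplus>\<^bsub>M\<^esub> g x),
     smult = (\<lambda>a f. \<lambda>x\<in>carrier M. a \<odot>\<^bsub>M\<^esub> f x)\<rparr>"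

definition is_representation ::
  "('r, 'c) ring_scheme \<Rightarrow> ('r, 'a, 'd) module_scheme \<Rightarrow> ('r, 'm, 'k) module_scheme
    \<Rightarrow> ('a \<Rightarrow> 'm \<Rightarrow> 'm) \<Rightarrow> bool"
  where "is_representation R A M \<pi> \<longleftrightarrow> module R M \<and> \<pi> \<in> alg_hom R A (End_alg R M)"

definition equivalent_representations ::
  "('r, 'c) ring_scheme \<Rightarrow> ('r, 'a, 'd) module_scheme
    \<Rightarrow> ('r, 'm, 'k) module_scheme \<Rightarrow> ('a \<Rightarrow> 'm \<Rightarrow> 'm)
    \<Rightarrow> ('r, 'n, 'l) module_scheme \<Rightarrow> ('a \<Rightarrow> 'n \<Rightarrow> 'n) \<Rightarrow> bool"
  where "equivalent_representations R A M \<pi> N \<phi> \<longleftrightarrow>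
    is_representation R A M \<pi> \<and> is_representation R A N \<phi> \<and>
    (\<exists>U\<in>mod_iso R M N. \<forall>a\<in>carrier A.
      compose (carrier M) U (\<pi> a) = compose (carrier M) (\<phi> a) U)"

section \<open>Algebras given by generators and relations\<close>

datatype ('r, 'g) alg_term =
    Gen 'g
  | Zero
  | Neg "('r, 'g) alg_term"
  | Add "('r, 'g) alg_term" "('r, 'g) alg_term"
  | Mul "('r, 'g) alg_term" "('r, 'g) alg_term"
  | Smult 'r "('r, 'g) alg_term"

fun sum_terms :: "('r, 'g) alg_term list \<Rightarrow> ('r, 'g) alg_term"
  where
    "sum_terms [] = Zero"
  | "sum_terms (t # ts) = Add t (sum_terms ts)"

primrec alg_terms_pred :: "('r, 'c) ring_scheme \<Rightarrow> 'g set \<Rightarrow> ('r, 'g) alg_term \<Rightarrow> bool"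
  where
    "alg_terms_pred R X (Gen g) \<longleftrightarrow> g \<in> X"
  | "alg_terms_pred R X Zero \<longleftrightarrow> True"
  | "alg_terms_pred R X (Neg t) \<longleftrightarrow> alg_terms_pred R X t"
  | "alg_terms_pred R X (Add t u) \<longleftrightarrow> alg_terms_pred R X t \<and> alg_terms_pred R X u"
  | "alg_terms_pred R X (Mul t u) \<longleftrightarrow> alg_terms_pred R X t \<and> alg_terms_pred R X u"
  | "alg_terms_pred R X (Smult a t) \<longleftrightarrow> a \<in> carrier R \<and> alg_terms_pred R X t"

definition alg_terms :: "('r, 'c) ring_scheme \<Rightarrow> 'g set \<Rightarrow> ('r, 'g) alg_term set"
  where "alg_terms R X = {t. alg_terms_pred R X t}"

text \<open>The least congruence on the terms over the generators \<open>X\<close> that contains the relations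
  \<open>E\<close> and all instances of the axioms of a nonunital \<open>R\<close>-algebra.\<close>

inductive_set alg_cong ::
  "('r, 'c) ring_scheme \<Rightarrow> 'g set \<Rightarrow> (('r, 'g) alg_term \<times> ('r, 'g) alg_term) set
    \<Rightarrow> (('r, 'g) alg_term \<times> ('r, 'g) alg_term) set"
  for R :: "('r, 'c) ring_scheme" (structure) and X :: "'g set"
    and E :: "(('r, 'g) alg_term \<times> ('r, 'g) alg_term) set"
  where
    rel: "\<lbrakk>(t, u) \<in> E; t \<in> alg_terms R X; u \<in> alg_terms R X\<rbrakk> \<Longrightarrow> (t, u) \<in> alg_cong R X E"
  | refl: "t \<in> alg_terms R X \<Longrightarrow> (t, t) \<in> alg_cong R X E"
  | sym: "(t, u) \<in> alg_cong R X E \<Longrightarrow> (u, t) \<in> alg_cong R X E"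
  | trans: "\<lbrakk>(t, u) \<in> alg_cong R X E; (u, w) \<in> alg_cong R X E\<rbrakk> \<Longrightarrow> (t, w) \<in> alg_cong R X E"
  | cong_neg: "(t, t') \<in> alg_cong R X E \<Longrightarrow> (Neg t, Neg t') \<in> alg_cong R X E"
  | cong_add: "\<lbrakk>(t, t') \<in> alg_cong R X E; (u, u') \<in> alg_cong R X E\<rbrakk> \<Longrightarrow>
      (Add t u, Add t' u') \<in> alg_cong R X E"
  | cong_mul: "\<lbrakk>(t, t') \<in> alg_cong R X E; (u, u') \<in> alg_cong R X E\<rbrakk> \<Longrightarrow>
      (Mul t u, Mul t' u') \<in> alg_cong R X E"
  | cong_smult: "\<lbrakk>a \<in> carrier R; (t, t') \<in> alg_cong R X E\<rbrakk> \<Longrightarrow>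
      (Smult a t, Smult a t') \<in> alg_cong R X E"
  | add_assoc: "\<lbrakk>t \<in> alg_terms R X; u \<in> alg_terms R X; w \<in> alg_terms R X\<rbrakk> \<Longrightarrow>
      (Add (Add t u) w, Add t (Add u w)) \<in> alg_cong R X E"
  | add_comm: "\<lbrakk>t \<in> alg_terms R X; u \<in> alg_terms R X\<rbrakk> \<Longrightarrow>
      (Add t u, Add u t) \<in> alg_cong R X E"
  | add_zero: "t \<in> alg_terms R X \<Longrightarrow> (Add Zero t, t) \<in> alg_cong R X E"
  | add_neg: "t \<in> alg_terms R X \<Longrightarrow> (Add (Neg t) t, Zero) \<in> alg_cong R X E"
  | smult_l_distr: "\<lbrakk>a \<in> carrier R; b \<in> carrier R; t \<in> alg_terms R X\<rbrakk> \<Longrightarrow>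
      (Smult (a \<oplus> b) t, Add (Smult a t) (Smult b t)) \<in> alg_cong R X E"
  | smult_r_distr: "\<lbrakk>a \<in> carrier R; t \<in> alg_terms R X; u \<in> alg_terms R X\<rbrakk> \<Longrightarrow>
      (Smult a (Add t u), Add (Smult a t) (Smult a u)) \<in> alg_cong R X E"
  | smult_smult: "\<lbrakk>a \<in> carrier R; b \<in> carrier R; t \<in> alg_terms R X\<rbrakk> \<Longrightarrow>
      (Smult (a \<otimes> b) t, Smult a (Smult b t)) \<in> alg_cong R X E"
  | smult_one: "t \<in> alg_terms R X \<Longrightarrow> (Smult \<one> t, t) \<in> alg_cong R X E"
  | mul_assoc: "\<lbrakk>t \<in> alg_terms R X; u \<in> alg_terms R X; w \<in> alg_terms R X\<rbrakk> \<Longrightarrow>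
      (Mul (Mul t u) w, Mul t (Mul u w)) \<in> alg_cong R X E"
  | mul_l_distr: "\<lbrakk>t \<in> alg_terms R X; u \<in> alg_terms R X; w \<in> alg_terms R X\<rbrakk> \<Longrightarrow>
      (Mul (Add t u) w, Add (Mul t w) (Mul u w)) \<in> alg_cong R X E"
  | mul_r_distr: "\<lbrakk>t \<in> alg_terms R X; u \<in> alg_terms R X; w \<in> alg_terms R X\<rbrakk> \<Longrightarrow>
      (Mul t (Add u w), Add (Mul t u) (Mul t w)) \<in> alg_cong R X E"
  | smult_mul_l: "\<lbrakk>a \<in> carrier R; t \<in> alg_terms R X; u \<in> alg_terms R X\<rbrakk> \<Longrightarrow>
      (Mul (Smult a t) u, Smult a (Mul t u)) \<in> alg_cong R X E"
  | smult_mul_r: "\<lbrakk>a \<in> carrier R; t \<in> alg_terms R X; u \<in> alg_terms R X\<rbrakk> \<Longrightarrow>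
      (Mul t (Smult a u), Smult a (Mul t u)) \<in> alg_cong R X E"

text \<open>The universal nonunital \<open>R\<close>-algebra generated by \<open>X\<close> subject to the relations \<open>E\<close>;
  its universal property is lemma \<open>presented_algebra_universal\<close> below.\<close>

definition presented_algebra ::
  "('r, 'c) ring_scheme \<Rightarrow> 'g set \<Rightarrow> (('r, 'g) alg_term \<times> ('r, 'g) alg_term) set
    \<Rightarrow> ('r, ('r, 'g) alg_term set) module"
  where "presented_algebra R X E =
    \<lparr>carrier = alg_terms R X // alg_cong R X E,
     monoid.mult = (\<lambda>C D. \<Union>t\<in>C. \<Union>u\<in>D. alg_cong R X E `` {Mul t u}),
     one = undefined,
     zero = alg_cong R X E `` {Zero},
     add = (\<lambda>C D. \<Union>t\<in>C. \<Union>u\<in>D. alg_cong R X E `` {Add t u}),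
     smult = (\<lambda>a C. \<Union>t\<in>C. alg_cong R X E `` {Smult a t})\<rparr>"

primrec alg_eval ::
  "('r, 'a, 'd) module_scheme \<Rightarrow> ('g \<Rightarrow> 'a) \<Rightarrow> ('r, 'g) alg_term \<Rightarrow> 'a"
  where
    "alg_eval A h (Gen g) = h g"
  | "alg_eval A h Zero = \<zero>\<^bsub>A\<^esub>"
  | "alg_eval A h (Neg t) = \<ominus>\<^bsub>A\<^esub> alg_eval A h t"
  | "alg_eval A h (Add t u) = alg_eval A h t \<oplus>\<^bsub>A\<^esub> alg_eval A h u"
  | "alg_eval A h (Mul t u) = alg_eval A h t \<otimes>\<^bsub>A\<^esub> alg_eval A h u"
  | "alg_eval A h (Smult a t) = a \<odot>\<^bsub>A\<^esub> alg_eval A h t"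

lemma alg_terms_simps [simp]:
  "Gen g \<in> alg_terms R X \<longleftrightarrow> g \<in> X"
  "Zero \<in> alg_terms R X"
  "Neg t \<in> alg_terms R X \<longleftrightarrow> t \<in> alg_terms R X"
  "Add t u \<in> alg_terms R X \<longleftrightarrow> t \<in> alg_terms R X \<and> u \<in> alg_terms R X"
  "Mul t u \<in> alg_terms R X \<longleftrightarrow> t \<in> alg_terms R X \<and> u \<in> alg_terms R X"
  "Smult a t \<in> alg_terms R X \<longleftrightarrow> a \<in> carrier R \<and> t \<in> alg_terms R X"
  by (auto simp: alg_terms_def)

lemma alg_cong_closed:
  assumes "cring R" "(t, u) \<in> alg_cong R X E"
  shows "t \<in> alg_terms R X \<and> u \<in> alg_terms R X"
proof -
  interpret cring R by fact
  show ?thesis using assms(2) by induction auto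
qed

lemma alg_cong_equiv:
  assumes "cring R"
  shows "equiv (alg_terms R X) (alg_cong R X E)"
proof (rule equivI)
  show "alg_cong R X E \<subseteq> alg_terms R X \<times> alg_terms R X"
    using alg_cong_closed[OF assms] by auto
  show "refl_on (alg_terms R X) (alg_cong R X E)"
    by (auto simp: refl_on_def intro: alg_cong.refl)
  show "sym (alg_cong R X E)" by (meson alg_cong.sym symI)
  show "trans (alg_cong R X E)" by (meson alg_cong.trans transI)
qed

lemma alg_cong_class_eq:
  assumes "cring R" "t \<in> alg_terms R X" "u \<in> alg_terms R X"
  shows "alg_cong R X E `` {t} = alg_cong R X E `` {u} \<longleftrightarrow> (t, u) \<in> alg_cong R X E"
  using eq_equiv_class_iff[OF alg_cong_equiv[OF assms(1)] assms(2,3)] .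

lemma presented_algebra_ops:
  fixes R :: "('r, 'c) ring_scheme" and E
  assumes R: "cring R" and t: "t \<in> alg_terms R X"
  defines "cl \<equiv> \<lambda>t. alg_cong R X E `` {t}" and "A \<equiv> presented_algebra R X E"
  shows "u \<in> alg_terms R X \<Longrightarrow> cl t \<oplus>\<^bsub>A\<^esub> cl u = cl (Add t u)"
    and "u \<in> alg_terms R X \<Longrightarrow> cl t \<otimes>\<^bsub>A\<^esub> cl u = cl (Mul t u)"
    and "a \<in> carrier R \<Longrightarrow> a \<odot>\<^bsub>A\<^esub> cl t = cl (Smult a t)"
    and "cl t \<in> carrier A"
proof -
  note eqv = alg_cong_equiv[OF R, of X E]
  note cl = alg_cong_closed[OF R]
  show "cl t \<oplus>\<^bsub>A\<^esub> cl u = cl (Add t u)" if u: "u \<in> alg_terms R X"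
  proof -
    have "congruent2 (alg_cong R X E) (alg_cong R X E) (\<lambda>t u. alg_cong R X E `` {Add t u})"
      by (intro congruent2I' equiv_class_eq[OF eqv] alg_cong.cong_add)
    from UN_equiv_class2[OF eqv eqv this t u] show ?thesis
      by (simp add: cl_def A_def presented_algebra_def)
  qed
  show "cl t \<otimes>\<^bsub>A\<^esub> cl u = cl (Mul t u)" if u: "u \<in> alg_terms R X"
  proof -
    have "congruent2 (alg_cong R X E) (alg_cong R X E) (\<lambda>t u. alg_cong R X E `` {Mul t u})"
      by (intro congruent2I' equiv_class_eq[OF eqv] alg_cong.cong_mul)
    from UN_equiv_class2[OF eqv eqv this t u] show ?thesis
      by (simp add: cl_def A_def presented_algebra_def)
  qed
  show "a \<odot>\<^bsub>A\<^esub> cl t = cl (Smult a t)" if a: "a \<in> carrier R"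
  proof -
    have "congruent (alg_cong R X E) (\<lambda>t. alg_cong R X E `` {Smult a t})"
      by (intro congruentI equiv_class_eq[OF eqv] alg_cong.cong_smult a)
    from UN_equiv_class[OF eqv this t] show ?thesis
      by (simp add: cl_def A_def presented_algebra_def)
  qed
  show "cl t \<in> carrier A"
    using t by (auto simp: cl_def A_def presented_algebra_def intro: quotientI)
qed

lemma presented_algebra_zero:
  "\<zero>\<^bsub>presented_algebra R X E\<^esub> = alg_cong R X E `` {Zero}"
  by (simp add: presented_algebra_def)

lemma presented_algebra_carrierE:
  assumes "x \<in> carrier (presented_algebra R X E)"
  obtains t where "t \<in> alg_terms R X" "x = alg_cong R X E `` {t}"
  using assms by (auto simp: presented_algebra_def elim: quotientE)

lemma presented_algebra_is_algebra:
  assumes R: "cring R"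
  shows "nonunital_algebra R (presented_algebra R X E)"
proof -
  let ?A = "presented_algebra R X E"
  interpret R: cring R by fact
  note ops = presented_algebra_ops[OF R] presented_algebra_zero
  note eq = alg_cong_class_eq[OF R]
  have ab: "abelian_group ?A"
  proof (rule abelian_groupI)
    fix x assume "x \<in> carrier ?A"
    then show "\<exists>y\<in>carrier ?A. y \<oplus>\<^bsub>?A\<^esub> x = \<zero>\<^bsub>?A\<^esub>"
    proof (rule presented_algebra_carrierE)
      fix t assume t: "t \<in> alg_terms R X" "x = alg_cong R X E `` {t}"
      show ?thesis
        by (rule bexI[of _ "alg_cong R X E `` {Neg t}"])
          (use t in \<open>simp_all add: ops eq alg_cong.add_neg\<close>)
    qed
  qed ((elim presented_algebra_carrierE)?,
      simp add: ops eq alg_cong.add_assoc alg_cong.add_comm alg_cong.add_zero)+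
  have "module R ?A"
    by (rule moduleI[OF R ab]; elim presented_algebra_carrierE; hypsubst)
      (auto simp: ops eq intro: alg_cong.smult_l_distr alg_cong.smult_r_distr
        alg_cong.smult_smult alg_cong.smult_one)
  then show ?thesis
    by (rule nonunital_algebra.intro, unfold_locales; elim presented_algebra_carrierE; hypsubst)
      (auto simp: ops eq intro: alg_cong.mul_assoc alg_cong.mul_l_distr
        alg_cong.mul_r_distr alg_cong.smult_mul_l alg_cong.smult_mul_r)
qed

lemma alg_eval_closed:
  assumes "nonunital_algebra R A" "h \<in> X \<rightarrow> carrier A" "t \<in> alg_terms R X"
  shows "alg_eval A h t \<in> carrier A"
proof -
  interpret nonunital_algebra R A by fact
  show ?thesis using assms(2,3) by (induction t) (auto intro: m_closed)
qed

lemma alg_eval_cong: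
  assumes A: "nonunital_algebra R A" and h: "h \<in> X \<rightarrow> carrier A"
    and E: "\<And>t u. \<lbrakk>(t, u) \<in> E; t \<in> alg_terms R X; u \<in> alg_terms R X\<rbrakk> \<Longrightarrow> alg_eval A h t = alg_eval A h u"
    and tu: "(t, u) \<in> alg_cong R X E"
  shows "alg_eval A h t = alg_eval A h u"
proof -
  interpret nonunital_algebra R A by fact
  note cl = alg_eval_closed[OF A h]
  show ?thesis using tu
    by induction (auto simp: E cl M.a_assoc M.l_neg m_assoc l_distr r_distr
        smult_l_distr smult_r_distr smult_assoc1 smult_assoc_l smult_assoc_r intro: M.a_comm)
qed

lemma presented_algebra_universal:
  assumes A: "nonunital_algebra R A" and h: "h \<in> X \<rightarrow> carrier A"
    and E: "\<And>t u. \<lbrakk>(t, u) \<in> E; t \<in> alg_terms R X; u \<in> alg_terms R X\<rbrakk> \<Longrightarrow> alg_eval A h t = alg_eval A h u"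
  shows "\<exists>!f. f \<in> alg_hom R (presented_algebra R X E) A \<and> (\<forall>g\<in>X. f (alg_cong R X E `` {Gen g}) = h g)"
proof -
  interpret A: nonunital_algebra R A by fact
  have R: "cring R" by (rule A.R.is_cring)
  let ?L = "presented_algebra R X E"
  let ?cl = "\<lambda>t. alg_cong R X E `` {t}"
  note ops = presented_algebra_ops[OF R] presented_algebra_zero and cl = alg_eval_closed[OF A h]
  note clo = alg_cong_closed[OF R]
  define f where "f = (\<lambda>x\<in>carrier ?L. alg_eval A h (SOME t. t \<in> x))"
  have f: "f (?cl t) = alg_eval A h t" if t: "t \<in> alg_terms R X" for t
  proof -
    have "t \<in> ?cl t" using t by (auto intro: alg_cong.refl)
    then have "(SOME u. u \<in> ?cl t) \<in> ?cl t" by (rule someI)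
    then have "(t, SOME u. u \<in> ?cl t) \<in> alg_cong R X E" by simp
    from alg_eval_cong[OF A h E this] show ?thesis
      by (simp add: f_def ops t)
  qed
  show ?thesis
  proof (rule ex1I)
    show "f \<in> alg_hom R ?L A \<and> (\<forall>g\<in>X. f (?cl (Gen g)) = h g)"
      unfolding alg_hom_def mod_hom_def
      by (auto simp: f ops cl
          elim!: presented_algebra_carrierE) (auto simp: f_def)
  next
    fix f' assume f': "f' \<in> alg_hom R ?L A \<and> (\<forall>g\<in>X. f' (?cl (Gen g)) = h g)"
    have hom: "f' (x \<oplus>\<^bsub>?L\<^esub> y) = f' x \<oplus>\<^bsub>A\<^esub> f' y" "f' (x \<otimes>\<^bsub>?L\<^esub> y) = f' x \<otimes>\<^bsub>A\<^esub> f' y"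
      if "x \<in> carrier ?L" "y \<in> carrier ?L" for x y
      using f' that by (auto simp: alg_hom_def mod_hom_def)
    have hom': "a \<in> carrier R \<Longrightarrow> f' (a \<odot>\<^bsub>?L\<^esub> x) = a \<odot>\<^bsub>A\<^esub> f' x" "f' x \<in> carrier A"
      if "x \<in> carrier ?L" for x a
      using f' that by (auto simp: alg_hom_def mod_hom_def)
    interpret L: nonunital_algebra R ?L by (rule presented_algebra_is_algebra[OF R])
    have z: "f' \<zero>\<^bsub>?L\<^esub> = \<zero>\<^bsub>A\<^esub>"
      using hom(1)[of "\<zero>\<^bsub>?L\<^esub>" "\<zero>\<^bsub>?L\<^esub>"] hom'(2)[of "\<zero>\<^bsub>?L\<^esub>"]
      by (simp add: A.add.l_cancel_one')
    have *: "f' (?cl t) = alg_eval A h t" if "t \<in> alg_terms R X" for t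
      using that
    proof (induction t)
      case (Neg t)
      then have "?cl (Neg t) \<oplus>\<^bsub>?L\<^esub> ?cl t = \<zero>\<^bsub>?L\<^esub>"
        by (simp add: ops equiv_class_eq[OF alg_cong_equiv[OF R] alg_cong.add_neg])
      with Neg show ?case
        using hom(1)[of "?cl (Neg t)" "?cl t"] hom'(2)[of "?cl (Neg t)"] z
        by (simp add: ops cl A.M.minus_equality[symmetric])
    qed (use f' in \<open>auto simp: ops(1-3)[symmetric] ops(4) z[unfolded presented_algebra_zero] hom hom'\<close>)
    show "f' = f"
    proof (rule extensionalityI[of _ "carrier ?L"])
      show "f' \<in> extensional (carrier ?L)" using f' by (simp add: alg_hom_def mod_hom_def PiE_def)
      show "f \<in> extensional (carrier ?L)" by (simp add: f_def)
      fix x assume "x \<in> carrier ?L"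
      then show "f' x = f x" by (auto elim!: presented_algebra_carrierE simp: * f)
    qed
  qed
qed

lemma presented_algebra_eval:
  assumes R: "cring R" and t: "t \<in> alg_terms R X"
  shows "alg_eval (presented_algebra R X E) (\<lambda>g. alg_cong R X E `` {Gen g}) t = alg_cong R X E `` {t}"
proof -
  let ?A = "presented_algebra R X E"
  interpret A: nonunital_algebra R ?A by (rule presented_algebra_is_algebra[OF R])
  note ops = presented_algebra_ops[OF R] presented_algebra_zero
  show ?thesis using t
  proof (induction t)
    case (Neg t)
    then have "alg_cong R X E `` {Neg t} \<oplus>\<^bsub>?A\<^esub> alg_cong R X E `` {t} = \<zero>\<^bsub>?A\<^esub>"
      by (simp add: ops alg_cong_class_eq[OF R] alg_cong.add_neg)
    with Neg show ?case by (simp add: ops A.M.minus_equality)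
  qed (simp_all add: ops)
qed

lemma alg_eval_sum_terms:
  assumes "nonunital_algebra R A" "\<And>x. x \<in> set xs \<Longrightarrow> alg_eval A h (f x) \<in> carrier A" "distinct xs"
  shows "alg_eval A h (sum_terms (map f xs)) = (\<Oplus>\<^bsub>A\<^esub>x\<in>set xs. alg_eval A h (f x))"
proof -
  interpret nonunital_algebra R A by fact
  show ?thesis using assms(2,3) by (induction xs) (auto simp: Pi_def)
qed

section \<open>Ultragraphs\<close>

record ('v, 'e) ugraph =
  verts :: "'v set"
  edges :: "'e set"
  src :: "'e \<Rightarrow> 'v"
  rng :: "'e \<Rightarrow> 'v set"

locale ultragraph =
  fixes G :: "('v, 'e) ugraph"
  assumes countable_verts: "countable (verts G)"
    and countable_edges: "countable (edges G)"
    and src_in_verts: "e \<in> edges G \<Longrightarrow> src G e \<in> verts G"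
    and rng_subset_verts: "e \<in> edges G \<Longrightarrow> rng G e \<subseteq> verts G"
    and rng_nonempty: "e \<in> edges G \<Longrightarrow> rng G e \<noteq> {}"

text \<open>The empty union is a finite union, so the empty set is always a generalized vertex.\<close>

inductive_set gen_verts :: "('v, 'e) ugraph \<Rightarrow> 'v set set"
  for G :: "('v, 'e) ugraph"
  where
    singleton: "v \<in> verts G \<Longrightarrow> {v} \<in> gen_verts G"
  | range: "e \<in> edges G \<Longrightarrow> rng G e \<in> gen_verts G"
  | Union: "\<lbrakk>finite F; \<forall>A\<in>F. A \<in> gen_verts G\<rbrakk> \<Longrightarrow> \<Union>F \<in> gen_verts G"
  | Inter: "\<lbrakk>finite F; F \<noteq> {}; \<forall>A\<in>F. A \<in> gen_verts G\<rbrakk> \<Longrightarrow> \<Inter>F \<in> gen_verts G"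

definition sinks :: "('v, 'e) ugraph \<Rightarrow> 'v set"
  where "sinks G = {v \<in> verts G. {e \<in> edges G. src G e = v} = {}}"

section \<open>The Leavitt path algebra of an ultragraph\<close>

datatype ('v, 'e) lpa_gen = Edge 'e | Ghost 'e | Proj "'v set"

definition lpa_gens :: "('v, 'e) ugraph \<Rightarrow> ('v, 'e) lpa_gen set"
  where "lpa_gens G = Edge ` edges G \<union> Ghost ` edges G \<union> Proj ` gen_verts G"

text \<open>In \<open>CK2\<close> the finite sum over the edges emitted by \<open>v\<close> is written once for every
  enumeration \<open>es\<close> of these edges.\<close>

inductive_set lpa_rels ::
  "('r, 'c) ring_scheme \<Rightarrow> ('v, 'e) ugraph
    \<Rightarrow> (('r, ('v, 'e) lpa_gen) alg_term \<times> ('r, ('v, 'e) lpa_gen) alg_term) set"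
  for R :: "('r, 'c) ring_scheme" and G :: "('v, 'e) ugraph"
  where
    proj_empty: "(Gen (Proj {}), Zero) \<in> lpa_rels R G"
  | proj_Int: "\<lbrakk>A \<in> gen_verts G; B \<in> gen_verts G\<rbrakk> \<Longrightarrow>
      (Mul (Gen (Proj A)) (Gen (Proj B)), Gen (Proj (A \<inter> B))) \<in> lpa_rels R G"
  | proj_Un: "\<lbrakk>A \<in> gen_verts G; B \<in> gen_verts G\<rbrakk> \<Longrightarrow>
      (Gen (Proj (A \<union> B)), Add (Add (Gen (Proj A)) (Gen (Proj B))) (Neg (Gen (Proj (A \<inter> B))))) \<in> lpa_rels R G"
  | src_edge: "e \<in> edges G \<Longrightarrow> (Mul (Gen (Proj {src G e})) (Gen (Edge e)), Gen (Edge e)) \<in> lpa_rels R G"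
  | edge_rng: "e \<in> edges G \<Longrightarrow> (Mul (Gen (Edge e)) (Gen (Proj (rng G e))), Gen (Edge e)) \<in> lpa_rels R G"
  | rng_ghost: "e \<in> edges G \<Longrightarrow> (Mul (Gen (Proj (rng G e))) (Gen (Ghost e)), Gen (Ghost e)) \<in> lpa_rels R G"
  | ghost_src: "e \<in> edges G \<Longrightarrow> (Mul (Gen (Ghost e)) (Gen (Proj {src G e})), Gen (Ghost e)) \<in> lpa_rels R G"
  | CK1: "\<lbrakk>e \<in> edges G; f \<in> edges G\<rbrakk> \<Longrightarrow>
      (Mul (Gen (Ghost e)) (Gen (Edge f)), if e = f then Gen (Proj (rng G e)) else Zero) \<in> lpa_rels R G"
  | CK2: "\<lbrakk>v \<in> verts G; es \<noteq> []; distinct es; set es = {e \<in> edges G. src G e = v}\<rbrakk> \<Longrightarrow>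
      (Gen (Proj {v}), sum_terms (map (\<lambda>e. Mul (Gen (Edge e)) (Gen (Ghost e))) es)) \<in> lpa_rels R G"

definition leavitt ::
  "('r, 'c) ring_scheme \<Rightarrow> ('v, 'e) ugraph
    \<Rightarrow> ('r, ('r, ('v, 'e) lpa_gen) alg_term set) module"
  where "leavitt R G = presented_algebra R (lpa_gens G) (lpa_rels R G)"

definition lpa_class ::
  "('r, 'c) ring_scheme \<Rightarrow> ('v, 'e) ugraph \<Rightarrow> ('v, 'e) lpa_gen
    \<Rightarrow> ('r, ('v, 'e) lpa_gen) alg_term set"
  where "lpa_class R G g = alg_cong R (lpa_gens G) (lpa_rels R G) `` {Gen g}"

definition lpa_s where "lpa_s R G e = lpa_class R G (Edge e)"
definition lpa_s_star where "lpa_s_star R G e = lpa_class R G (Ghost e)"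
definition lpa_p where "lpa_p R G A = lpa_class R G (Proj A)"

subsection \<open>The universal property\<close>

lemma gen_verts_empty: "{} \<in> gen_verts G"
  using gen_verts.Union[of "{}" G] by simp
lemma gen_verts_Int: "\<lbrakk>A \<in> gen_verts G; B \<in> gen_verts G\<rbrakk> \<Longrightarrow> A \<inter> B \<in> gen_verts G"
  using gen_verts.Inter[of "{A, B}" G] by simp
lemma gen_verts_Un: "\<lbrakk>A \<in> gen_verts G; B \<in> gen_verts G\<rbrakk> \<Longrightarrow> A \<union> B \<in> gen_verts G"
  using gen_verts.Union[of "{A, B}" G] by simp

lemma leavitt_is_algebra: "cring R \<Longrightarrow> nonunital_algebra R (leavitt R G)"
  unfolding leavitt_def by (rule presented_algebra_is_algebra)

text \<open>The families subject to the defining relations of the Leavitt path algebra.\<close>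

locale leavitt_family = nonunital_algebra R A
  for R :: "('r, 'c) ring_scheme" and G :: "('v, 'e) ugraph" and A :: "('r, 'a, 'd) module_scheme"
    and p :: "'v set \<Rightarrow> 'a" and s s_star :: "'e \<Rightarrow> 'a" +
  assumes p_closed: "B \<in> gen_verts G \<Longrightarrow> p B \<in> carrier A"
    and s_closed: "e \<in> edges G \<Longrightarrow> s e \<in> carrier A"
    and s_star_closed: "e \<in> edges G \<Longrightarrow> s_star e \<in> carrier A"
    and p_empty: "p {} = \<zero>\<^bsub>A\<^esub>"
    and p_Int: "\<lbrakk>B \<in> gen_verts G; C \<in> gen_verts G\<rbrakk> \<Longrightarrow> p B \<otimes>\<^bsub>A\<^esub> p C = p (B \<inter> C)"
    and p_Un: "\<lbrakk>B \<in> gen_verts G; C \<in> gen_verts G\<rbrakk> \<Longrightarrow>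
      p (B \<union> C) = p B \<oplus>\<^bsub>A\<^esub> p C \<ominus>\<^bsub>A\<^esub> p (B \<inter> C)"
    and p_s: "e \<in> edges G \<Longrightarrow> p {src G e} \<otimes>\<^bsub>A\<^esub> s e = s e"
    and s_p: "e \<in> edges G \<Longrightarrow> s e \<otimes>\<^bsub>A\<^esub> p (rng G e) = s e"
    and p_s_star: "e \<in> edges G \<Longrightarrow> p (rng G e) \<otimes>\<^bsub>A\<^esub> s_star e = s_star e"
    and s_star_p: "e \<in> edges G \<Longrightarrow> s_star e \<otimes>\<^bsub>A\<^esub> p {src G e} = s_star e"
    and s_star_s: "\<lbrakk>e \<in> edges G; f \<in> edges G\<rbrakk> \<Longrightarrow>
      s_star e \<otimes>\<^bsub>A\<^esub> s f = (if e = f then p (rng G e) else \<zero>\<^bsub>A\<^esub>)"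
    and p_sum: "\<lbrakk>v \<in> verts G; {e \<in> edges G. src G e = v} \<noteq> {}; finite {e \<in> edges G. src G e = v}\<rbrakk> \<Longrightarrow>
      p {v} = (\<Oplus>\<^bsub>A\<^esub>e\<in>{e \<in> edges G. src G e = v}. s e \<otimes>\<^bsub>A\<^esub> s_star e)"

lemma sum_terms_closed:
  "sum_terms ts \<in> alg_terms R X \<longleftrightarrow> set ts \<subseteq> alg_terms R X"
  by (induction ts) auto

lemma lpa_rels_closed:
  assumes "ultragraph G" "(t, u) \<in> lpa_rels R G"
  shows "t \<in> alg_terms R (lpa_gens G) \<and> u \<in> alg_terms R (lpa_gens G)"
proof -
  interpret ultragraph G by fact
  show ?thesis using assms(2)
    by cases (auto simp: lpa_gens_def gen_verts_empty gen_verts_Int gen_verts_Un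
        gen_verts.singleton gen_verts.range src_in_verts sum_terms_closed)
qed

lemma leavitt_leavitt_family:
  assumes R: "cring R" and G: "ultragraph G"
  shows "leavitt_family R G (leavitt R G) (lpa_p R G) (lpa_s R G) (lpa_s_star R G)"
proof -
  let ?L = "leavitt R G"
  interpret ultragraph G by fact
  interpret L: nonunital_algebra R ?L by (rule leavitt_is_algebra[OF R])
  define h where "h = lpa_class R G"
  have eval: "alg_eval ?L h t = alg_cong R (lpa_gens G) (lpa_rels R G) `` {t}"
    if "t \<in> alg_terms R (lpa_gens G)" for t
    using presented_algebra_eval[OF R that] unfolding leavitt_def h_def lpa_class_def .
  have rel: "alg_eval ?L h t = alg_eval ?L h u" if tu: "(t, u) \<in> lpa_rels R G" for t u
    using lpa_rels_closed[OF G tu] by (simp add: eval alg_cong_class_eq[OF R] alg_cong.rel[OF tu])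
  have h: "h \<in> lpa_gens G \<rightarrow> carrier ?L"
    unfolding leavitt_def h_def lpa_class_def by (auto intro: presented_algebra_ops(4)[OF R])
  note defs = lpa_p_def lpa_s_def lpa_s_star_def h_def[symmetric]
  note gens = lpa_gens_def
  show ?thesis
  proof (unfold_locales, unfold defs)
    fix v assume v: "v \<in> verts G" "{e \<in> edges G. src G e = v} \<noteq> {}" "finite {e \<in> edges G. src G e = v}"
    obtain es where es: "set es = {e \<in> edges G. src G e = v}" "distinct es"
      using finite_distinct_list[OF v(3)] by blast
    then have "es \<noteq> []" using v(2) by auto
    from rel[OF lpa_rels.CK2[OF v(1) this es(2,1)]]
    have "h (Proj {v}) = alg_eval ?L h (sum_terms (map (\<lambda>e. Mul (Gen (Edge e)) (Gen (Ghost e))) es))"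
      by simp
    also have "\<dots> = (\<Oplus>\<^bsub>?L\<^esub>e\<in>set es. alg_eval ?L h (Mul (Gen (Edge e)) (Gen (Ghost e))))"
      by (rule alg_eval_sum_terms[OF L.nonunital_algebra_axioms _ es(2)])
        (use h es in \<open>auto simp: gens intro!: L.m_closed\<close>)
    finally show "h (Proj {v}) = (\<Oplus>\<^bsub>?L\<^esub>e\<in>{e \<in> edges G. src G e = v}. h (Edge e) \<otimes>\<^bsub>?L\<^esub> h (Ghost e))"
      by (simp add: es)
  qed (use h lpa_rels.intros[THEN rel] in \<open>auto simp: gens a_minus_def split: if_splits\<close>)
qed

lemma leavitt_universal:
  assumes "leavitt_family R G A p s s_star"
  shows "\<exists>!f. f \<in> alg_hom R (leavitt R G) A \<and> (\<forall>B\<in>gen_verts G. f (lpa_p R G B) = p B) \<and>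
    (\<forall>e\<in>edges G. f (lpa_s R G e) = s e) \<and> (\<forall>e\<in>edges G. f (lpa_s_star R G e) = s_star e)"
proof -
  interpret A: leavitt_family R G A p s s_star by fact
  note A = A.nonunital_algebra_axioms
  define h where "h = case_lpa_gen s s_star p"
  have h: "h \<in> lpa_gens G \<rightarrow> carrier A"
    using A.p_closed A.s_closed A.s_star_closed by (auto simp: h_def lpa_gens_def)
  have E: "alg_eval A h x = alg_eval A h y" if "(x, y) \<in> lpa_rels R G" for x y
    using that
  proof cases
    case (CK2 v es)
    have "alg_eval A h (sum_terms (map (\<lambda>e. Mul (Gen (Edge e)) (Gen (Ghost e))) es)) =
      (\<Oplus>\<^bsub>A\<^esub>e\<in>set es. alg_eval A h (Mul (Gen (Edge e)) (Gen (Ghost e))))"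
      using CK2 A.s_closed A.s_star_closed by (intro alg_eval_sum_terms[OF A]) (auto simp: h_def intro!: A.m_closed)
    also have "\<dots> = p {v}"
    proof -
      have "finite {e \<in> edges G. src G e = v}" "{e \<in> edges G. src G e = v} \<noteq> {}"
        using CK2 by (metis List.finite_set, metis set_empty)
      with A.p_sum[of v] CK2 show ?thesis by (simp add: h_def)
    qed
    finally show ?thesis using CK2 by (simp add: h_def)
  qed (simp_all add: h_def A.p_empty A.p_Int A.p_Un A.p_s A.s_p A.p_s_star A.s_star_p A.s_star_s a_minus_def)
  have *: "(\<forall>g\<in>lpa_gens G. f (lpa_class R G g) = h g) \<longleftrightarrow> (\<forall>B\<in>gen_verts G. f (lpa_p R G B) = p B) \<and>
    (\<forall>e\<in>edges G. f (lpa_s R G e) = s e) \<and> (\<forall>e\<in>edges G. f (lpa_s_star R G e) = s_star e)" for f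
    by (auto simp: lpa_gens_def h_def lpa_s_def lpa_s_star_def lpa_p_def)
  from presented_algebra_universal[where E = "lpa_rels R G", OF A h E] show ?thesis
    unfolding leavitt_def[symmetric] lpa_class_def[symmetric] * .
qed

section \<open>Paths\<close>

text \<open>\<open>FinPath \<alpha> v\<close> with \<open>\<alpha> \<noteq> []\<close> is the pair \<open>(\<alpha>, v)\<close>, and \<open>FinPath [] v\<close> is the pair \<open>(v, v)\<close>.\<close>

datatype ('v, 'e) path = FinPath "'e list" 'v | InfPath "'e stream"

definition finite_path :: "('v, 'e) ugraph \<Rightarrow> 'e list \<Rightarrow> bool"
  where "finite_path G \<alpha> \<longleftrightarrow> \<alpha> \<noteq> [] \<and> set \<alpha> \<subseteq> edges G \<and>
    (\<forall>i. Suc i < length \<alpha> \<longrightarrow> src G (\<alpha> ! Suc i) \<in> rng G (\<alpha> ! i))"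

definition paths_fin :: "('v, 'e) ugraph \<Rightarrow> ('v, 'e) path set"
  where "paths_fin G = {FinPath \<alpha> v | \<alpha> v. finite_path G \<alpha> \<and> v \<in> rng G (last \<alpha>) \<inter> sinks G} \<union>
    {FinPath [] v | v. v \<in> sinks G}"

definition paths_inf :: "('v, 'e) ugraph \<Rightarrow> ('v, 'e) path set"
  where "paths_inf G = {InfPath \<omega> | \<omega>.
    (\<forall>i. \<omega> !! i \<in> edges G) \<and> (\<forall>i. src G (\<omega> !! Suc i) \<in> rng G (\<omega> !! i))}"

definition paths :: "('v, 'e) ugraph \<Rightarrow> ('v, 'e) path set"
  where "paths G = paths_fin G \<union> paths_inf G"

fun path_src :: "('v, 'e) ugraph \<Rightarrow> ('v, 'e) path \<Rightarrow> 'v"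
  where
    "path_src G (FinPath [] v) = v"
  | "path_src G (FinPath (e # \<alpha>) v) = src G e"
  | "path_src G (InfPath \<omega>) = src G (shd \<omega>)"

fun first_edge :: "('v, 'e) path \<Rightarrow> 'e option"
  where
    "first_edge (FinPath [] v) = None"
  | "first_edge (FinPath (e # \<alpha>) v) = Some e"
  | "first_edge (InfPath \<omega>) = Some (shd \<omega>)"

fun path_cons :: "'e \<Rightarrow> ('v, 'e) path \<Rightarrow> ('v, 'e) path"
  where
    "path_cons e (FinPath \<alpha> v) = FinPath (e # \<alpha>) v"
  | "path_cons e (InfPath \<omega>) = InfPath (e ## \<omega>)"

fun path_tl :: "('v, 'e) path \<Rightarrow> ('v, 'e) path"
  where
    "path_tl (FinPath \<alpha> v) = FinPath (tl \<alpha>) v"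
  | "path_tl (InfPath \<omega>) = InfPath (stl \<omega>)"

section \<open>The two representations\<close>

definition finsupp_module :: "('r, 'c) ring_scheme \<Rightarrow> 'x set \<Rightarrow> ('r, 'x \<Rightarrow> 'r) module"
  where "finsupp_module R X =
    \<lparr>carrier = {\<phi> \<in> X \<rightarrow>\<^sub>E carrier R. finite {x \<in> X. \<phi> x \<noteq> \<zero>\<^bsub>R\<^esub>}},
     monoid.mult = undefined,
     one = undefined,
     zero = (\<lambda>x\<in>X. \<zero>\<^bsub>R\<^esub>),
     add = (\<lambda>\<phi> \<psi>. \<lambda>x\<in>X. \<phi> x \<oplus>\<^bsub>R\<^esub> \<psi> x),
     smult = (\<lambda>a \<phi>. \<lambda>x\<in>X. a \<otimes>\<^bsub>R\<^esub> \<phi> x)\<rparr>"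

text \<open>Uniqueness of coefficients is stated for the family \<open>b\<close>, which need not be injective
  when \<open>R\<close> is the zero ring.\<close>

definition free_module_with_basis ::
  "('r, 'c) ring_scheme \<Rightarrow> ('r, 'm, 'd) module_scheme \<Rightarrow> 'x set \<Rightarrow> ('x \<Rightarrow> 'm) \<Rightarrow> bool"
  where "free_module_with_basis R M X b \<longleftrightarrow> module R M \<and> b \<in> X \<rightarrow> carrier M \<and>
    (\<forall>m\<in>carrier M. \<exists>!c. c \<in> carrier (finsupp_module R X) \<and>
      m = (\<Oplus>\<^bsub>M\<^esub>x\<in>{x \<in> X. c x \<noteq> \<zero>\<^bsub>R\<^esub>}. c x \<odot>\<^bsub>M\<^esub> b x))"

text \<open>The formulas below on the generators determine each of the two representations uniquely,
  so the descriptions are definite. On a path of length zero \<open>path_tl\<close> is junk, but it is only used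
  on paths that have a first edge.\<close>

definition basis_rep ::
  "('r, 'c) ring_scheme \<Rightarrow> ('v, 'e) ugraph \<Rightarrow> ('r, 'm, 'd) module_scheme
    \<Rightarrow> (('v, 'e) path \<Rightarrow> 'm) \<Rightarrow> ('r, ('v, 'e) lpa_gen) alg_term set \<Rightarrow> 'm \<Rightarrow> 'm"
  where "basis_rep R G M b = (THE \<pi>. is_representation R (leavitt R G) M \<pi> \<and>
    (\<forall>A\<in>gen_verts G. \<forall>\<alpha>\<in>paths G.
      \<pi> (lpa_p R G A) (b \<alpha>) = (if path_src G \<alpha> \<in> A then b \<alpha> else \<zero>\<^bsub>M\<^esub>)) \<and>
    (\<forall>e\<in>edges G. \<forall>\<alpha>\<in>paths G.
      \<pi> (lpa_s R G e) (b \<alpha>) = (if path_src G \<alpha> \<in> rng G e then b (path_cons e \<alpha>) else \<zero>\<^bsub>M\<^esub>)) \<and>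
    (\<forall>e\<in>edges G. \<forall>\<alpha>\<in>paths G.
      \<pi> (lpa_s_star R G e) (b \<alpha>) = (if first_edge \<alpha> = Some e then b (path_tl \<alpha>) else \<zero>\<^bsub>M\<^esub>)))"

definition src_set :: "('v, 'e) ugraph \<Rightarrow> 'v set \<Rightarrow> ('v, 'e) path set"
  where "src_set G A = {x \<in> paths G. path_src G x \<in> A}"

definition edge_set :: "('v, 'e) ugraph \<Rightarrow> 'e \<Rightarrow> ('v, 'e) path set"
  where "edge_set G e = {x \<in> paths G. first_edge x = Some e}"

definition edge_map :: "('v, 'e) ugraph \<Rightarrow> 'e \<Rightarrow> ('v, 'e) path \<Rightarrow> ('v, 'e) path"
  where "edge_map G e = (\<lambda>x\<in>src_set G (rng G e). path_cons e x)"

definition function_rep ::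
  "('r, 'c) ring_scheme \<Rightarrow> ('v, 'e) ugraph
    \<Rightarrow> ('r, ('v, 'e) lpa_gen) alg_term set \<Rightarrow> (('v, 'e) path \<Rightarrow> 'r) \<Rightarrow> ('v, 'e) path \<Rightarrow> 'r"
  where "function_rep R G =
    (THE \<phi>. is_representation R (leavitt R G) (finsupp_module R (paths G)) \<phi> \<and>
    (\<forall>A\<in>gen_verts G. \<forall>f\<in>carrier (finsupp_module R (paths G)).
      \<phi> (lpa_p R G A) f = (\<lambda>x\<in>paths G. if x \<in> src_set G A then f x else \<zero>\<^bsub>R\<^esub>)) \<and>
    (\<forall>e\<in>edges G. \<forall>f\<in>carrier (finsupp_module R (paths G)).
      \<phi> (lpa_s R G e) f = (\<lambda>x\<in>paths G. if x \<in> edge_set G e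
        then f (inv_into (src_set G (rng G e)) (edge_map G e) x) else \<zero>\<^bsub>R\<^esub>)) \<and>
    (\<forall>e\<in>edges G. \<forall>f\<in>carrier (finsupp_module R (paths G)).
      \<phi> (lpa_s_star R G e) f = (\<lambda>x\<in>paths G. if x \<in> src_set G (rng G e)
        then f (edge_map G e x) else \<zero>\<^bsub>R\<^esub>)))"

end

theory Submission
  imports Defs
begin

text \<open>A finitely supported function \<open>c\<close> on the paths is the coordinate vector of
  \<open>\<Sum> c \<alpha> b\<^sub>\<alpha>\<close>, so forming linear combinations is a linear isomorphism \<open>V\<close> from the functions
  onto the free module; it sends the indicator function \<open>\<delta>\<^sub>\<alpha>\<close> to \<open>b\<^sub>\<alpha>\<close>. The formulas
  that define \<open>\<phi>\<close> on functions become, at the \<open>\<delta>\<^sub>\<alpha>\<close>, exactly the formulas that define \<open>\<pi>\<close>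
  at the \<open>b\<^sub>\<alpha>\<close>: restricting to the paths that start in \<open>A\<close> keeps or kills \<open>\<delta>\<^sub>\<alpha>\<close>, and
  pulling a function back along \<open>e\<alpha> \<mapsto> \<alpha>\<close> or \<open>\<alpha> \<mapsto> e\<alpha>\<close> moves its support the opposite way
  (\<open>path_ops_std_basis\<close>). Hence \<open>V\<inverse>\<close> intertwines \<open>\<pi>\<close> and \<open>\<phi>\<close>.

  Both representations are given by definite description, so one also has to show that the
  descriptions are met by exactly one representation. For \<open>\<phi>\<close> this is the universal property of the
  Leavitt path algebra, once the operators on functions are known to satisfy its relations
  (\<open>path_ops_leavitt_family\<close>). All three kinds of operators are pullbacks along partial injections
  of the set of paths, and such pullbacks compose like the partial injections, so the relations
  reduce to identities between sets of paths and maps on them. For \<open>\<pi>\<close>, existence follows by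
  transporting \<open>\<phi>\<close> along \<open>V\<close>. Uniqueness follows by transporting back: any candidate becomes a
  representation on functions that agrees with \<open>\<phi>\<close> on generators at every \<open>\<delta>\<^sub>\<alpha>\<close>, therefore on
  all generators, therefore everywhere (\<open>basis_rep_eq_transport\<close>).\<close>

section \<open>Module homomorphisms and endomorphism algebras\<close>

lemma mod_homI:
  assumes "f \<in> carrier M \<rightarrow>\<^sub>E carrier N"
    and "\<And>x y. \<lbrakk>x \<in> carrier M; y \<in> carrier M\<rbrakk> \<Longrightarrow> f (x \<oplus>\<^bsub>M\<^esub> y) = f x \<oplus>\<^bsub>N\<^esub> f y"
    and "\<And>a x. \<lbrakk>a \<in> carrier R; x \<in> carrier M\<rbrakk> \<Longrightarrow> f (a \<odot>\<^bsub>M\<^esub> x) = a \<odot>\<^bsub>N\<^esub> f x"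
  shows "f \<in> mod_hom R M N"
  using assms by (simp add: mod_hom_def)

lemma mod_homD:
  assumes "f \<in> mod_hom R M N"
  shows "f \<in> carrier M \<rightarrow>\<^sub>E carrier N" and "f \<in> extensional (carrier M)"
    and "x \<in> carrier M \<Longrightarrow> f x \<in> carrier N"
    and "\<lbrakk>x \<in> carrier M; y \<in> carrier M\<rbrakk> \<Longrightarrow> f (x \<oplus>\<^bsub>M\<^esub> y) = f x \<oplus>\<^bsub>N\<^esub> f y"
    and "\<lbrakk>a \<in> carrier R; x \<in> carrier M\<rbrakk> \<Longrightarrow> f (a \<odot>\<^bsub>M\<^esub> x) = a \<odot>\<^bsub>N\<^esub> f x"
  using assms by (auto simp: mod_hom_def PiE_def)

lemma mod_hom_zero:
  assumes "module R M" "module R N" "f \<in> mod_hom R M N"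
  shows "f \<zero>\<^bsub>M\<^esub> = \<zero>\<^bsub>N\<^esub>"
proof -
  interpret M: module R M by fact
  interpret N: module R N by fact
  show ?thesis
    using mod_homD(5)[OF assms(3), of "\<zero>\<^bsub>R\<^esub>" "\<zero>\<^bsub>M\<^esub>"] mod_homD(3)[OF assms(3), of "\<zero>\<^bsub>M\<^esub>"] by simp
qed

lemma mod_hom_eqI:
  assumes "f \<in> mod_hom R M N" "g \<in> mod_hom R M N" "\<And>x. x \<in> carrier M \<Longrightarrow> f x = g x"
  shows "f = g"
  using extensionalityI[OF mod_homD(2)[OF assms(1)] mod_homD(2)[OF assms(2)]] assms(3) by blast

lemma mod_hom_compose:
  assumes "module R M" "f \<in> mod_hom R M N" "g \<in> mod_hom R N K"
  shows "compose (carrier M) g f \<in> mod_hom R M K"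
proof -
  interpret M: module R M by fact
  show ?thesis
    by (rule mod_homI)
      (auto simp: compose_def mod_homD[OF assms(2)] mod_homD[OF assms(3)])
qed

lemma End_alg_simps:
  "carrier (End_alg R M) = mod_hom R M M"
  "f \<otimes>\<^bsub>End_alg R M\<^esub> g = compose (carrier M) f g"
  "\<zero>\<^bsub>End_alg R M\<^esub> = (\<lambda>x\<in>carrier M. \<zero>\<^bsub>M\<^esub>)"
  "f \<oplus>\<^bsub>End_alg R M\<^esub> g = (\<lambda>x\<in>carrier M. f x \<oplus>\<^bsub>M\<^esub> g x)"
  "a \<odot>\<^bsub>End_alg R M\<^esub> f = (\<lambda>x\<in>carrier M. a \<odot>\<^bsub>M\<^esub> f x)"
  by (simp_all add: End_alg_def)

lemma End_alg_is_algebra: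
  assumes "module R M"
  shows "nonunital_algebra R (End_alg R M)"
proof -
  interpret M: module R M by fact
  let ?E = "End_alg R M"
  have add: "f \<oplus>\<^bsub>?E\<^esub> g \<in> carrier ?E" if "f \<in> carrier ?E" "g \<in> carrier ?E" for f g
    unfolding End_alg_simps using that[unfolded End_alg_simps]
    by (intro mod_homI) (auto simp: mod_homD M.smult_r_distr M.M.add.m_ac)
  have smult: "a \<odot>\<^bsub>?E\<^esub> f \<in> carrier ?E" if "a \<in> carrier R" "f \<in> carrier ?E" for a f
    unfolding End_alg_simps using that[unfolded End_alg_simps]
    by (intro mod_homI)
      (auto simp: mod_homD M.smult_r_distr M.smult_assoc1[symmetric] M.R.m_comm)
  have zero: "\<zero>\<^bsub>?E\<^esub> \<in> carrier ?E"
    unfolding End_alg_simps by (intro mod_homI) auto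
  have eqI: "f = g" if "f \<in> carrier ?E" "g \<in> carrier ?E" "\<And>x. x \<in> carrier M \<Longrightarrow> f x = g x" for f g
    using that mod_hom_eqI unfolding End_alg_simps by blast
  have ab: "abelian_group ?E"
  proof (rule abelian_groupI)
    fix f assume f: "f \<in> carrier ?E"
    \<comment> \<open>Taking \<open>-1 \<cdot> f\<close> as the additive inverse reuses closure under scalar multiplication.\<close>
    show "\<exists>g\<in>carrier ?E. g \<oplus>\<^bsub>?E\<^esub> f = \<zero>\<^bsub>?E\<^esub>"
    proof
      show m: "(\<ominus>\<^bsub>R\<^esub> \<one>\<^bsub>R\<^esub>) \<odot>\<^bsub>?E\<^esub> f \<in> carrier ?E" using f by (intro smult) auto
      show "(\<ominus>\<^bsub>R\<^esub> \<one>\<^bsub>R\<^esub>) \<odot>\<^bsub>?E\<^esub> f \<oplus>\<^bsub>?E\<^esub> f = \<zero>\<^bsub>?E\<^esub>"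
        by (rule eqI[OF add[OF m f] zero])
          (use f in \<open>auto simp: End_alg_simps mod_homD M.smult_l_minus M.M.l_neg\<close>)
    qed
  next
    fix f g h assume fgh: "f \<in> carrier ?E" "g \<in> carrier ?E" "h \<in> carrier ?E"
    show "f \<oplus>\<^bsub>?E\<^esub> g \<oplus>\<^bsub>?E\<^esub> h = f \<oplus>\<^bsub>?E\<^esub> (g \<oplus>\<^bsub>?E\<^esub> h)"
      using fgh by (intro eqI add) (auto simp: End_alg_simps mod_homD M.M.a_assoc)
  next
    fix f g assume fg: "f \<in> carrier ?E" "g \<in> carrier ?E"
    show "f \<oplus>\<^bsub>?E\<^esub> g = g \<oplus>\<^bsub>?E\<^esub> f"
      using fg by (intro eqI add) (auto simp: End_alg_simps mod_homD M.M.a_comm)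
  next
    fix f assume f: "f \<in> carrier ?E"
    show "\<zero>\<^bsub>?E\<^esub> \<oplus>\<^bsub>?E\<^esub> f = f"
      using f by (intro eqI add zero) (auto simp: End_alg_simps mod_homD)
  qed (fact add zero)+
  have mult: "f \<otimes>\<^bsub>?E\<^esub> g \<in> carrier ?E" if "f \<in> carrier ?E" "g \<in> carrier ?E" for f g
    using that mod_hom_compose[OF assms] unfolding End_alg_simps by blast
  have module: "module R ?E"
  proof (rule moduleI[OF M.R.is_cring ab smult])
    fix f assume "f \<in> carrier ?E"
    then show "\<one>\<^bsub>R\<^esub> \<odot>\<^bsub>?E\<^esub> f = f"
      by (intro eqI smult) (auto simp: End_alg_simps mod_homD)
  next
    fix a b f assume "a \<in> carrier R" "b \<in> carrier R" "f \<in> carrier ?E"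
    then show "(a \<oplus>\<^bsub>R\<^esub> b) \<odot>\<^bsub>?E\<^esub> f = a \<odot>\<^bsub>?E\<^esub> f \<oplus>\<^bsub>?E\<^esub> b \<odot>\<^bsub>?E\<^esub> f"
      by (intro eqI smult add) (auto simp: End_alg_simps mod_homD M.smult_l_distr)
  next
    fix a f g assume "a \<in> carrier R" "f \<in> carrier ?E" "g \<in> carrier ?E"
    then show "a \<odot>\<^bsub>?E\<^esub> (f \<oplus>\<^bsub>?E\<^esub> g) = a \<odot>\<^bsub>?E\<^esub> f \<oplus>\<^bsub>?E\<^esub> a \<odot>\<^bsub>?E\<^esub> g"
      by (intro eqI smult add) (auto simp: End_alg_simps mod_homD M.smult_r_distr)
  next
    fix a b f assume "a \<in> carrier R" "b \<in> carrier R" "f \<in> carrier ?E"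
    then show "(a \<otimes>\<^bsub>R\<^esub> b) \<odot>\<^bsub>?E\<^esub> f = a \<odot>\<^bsub>?E\<^esub> (b \<odot>\<^bsub>?E\<^esub> f)"
      by (intro eqI smult) (auto simp: End_alg_simps mod_homD M.smult_assoc1)
  qed
  show ?thesis
  proof (rule nonunital_algebra.intro[OF module], unfold_locales)
    fix f g assume "f \<in> carrier ?E" "g \<in> carrier ?E"
    then show "f \<otimes>\<^bsub>?E\<^esub> g \<in> carrier ?E" by (rule mult)
  next
    fix f g h assume "f \<in> carrier ?E" "g \<in> carrier ?E" "h \<in> carrier ?E"
    then show "f \<otimes>\<^bsub>?E\<^esub> g \<otimes>\<^bsub>?E\<^esub> h = f \<otimes>\<^bsub>?E\<^esub> (g \<otimes>\<^bsub>?E\<^esub> h)"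
      and "(f \<oplus>\<^bsub>?E\<^esub> g) \<otimes>\<^bsub>?E\<^esub> h = f \<otimes>\<^bsub>?E\<^esub> h \<oplus>\<^bsub>?E\<^esub> g \<otimes>\<^bsub>?E\<^esub> h"
      and "f \<otimes>\<^bsub>?E\<^esub> (g \<oplus>\<^bsub>?E\<^esub> h) = f \<otimes>\<^bsub>?E\<^esub> g \<oplus>\<^bsub>?E\<^esub> f \<otimes>\<^bsub>?E\<^esub> h"
      by (intro eqI mult add; auto simp: End_alg_simps mod_homD compose_eq)+
  next
    fix a f g assume "a \<in> carrier R" "f \<in> carrier ?E" "g \<in> carrier ?E"
    then show "(a \<odot>\<^bsub>?E\<^esub> f) \<otimes>\<^bsub>?E\<^esub> g = a \<odot>\<^bsub>?E\<^esub> (f \<otimes>\<^bsub>?E\<^esub> g)"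
      and "f \<otimes>\<^bsub>?E\<^esub> (a \<odot>\<^bsub>?E\<^esub> g) = a \<odot>\<^bsub>?E\<^esub> (f \<otimes>\<^bsub>?E\<^esub> g)"
      by (intro eqI mult smult; auto simp: End_alg_simps mod_homD compose_eq)+
  qed
qed

section \<open>Transport of representations along isomorphisms\<close>

definition transport_rep ::
  "('r, 'a, 'd) module_scheme \<Rightarrow> ('r, 'n, 'k) module_scheme
    \<Rightarrow> ('m \<Rightarrow> 'n) \<Rightarrow> ('n \<Rightarrow> 'm) \<Rightarrow> ('a \<Rightarrow> 'm \<Rightarrow> 'm) \<Rightarrow> 'a \<Rightarrow> 'n \<Rightarrow> 'n"
  where "transport_rep A N U V \<pi> = (\<lambda>a\<in>carrier A. \<lambda>n\<in>carrier N. U (\<pi> a (V n)))"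

lemma is_representationD:
  assumes "is_representation R A M \<pi>"
  shows "module R M" and "\<pi> \<in> alg_hom R A (End_alg R M)" and "\<pi> \<in> extensional (carrier A)"
    and "a \<in> carrier A \<Longrightarrow> \<pi> a \<in> mod_hom R M M"
  using assms by (auto simp: is_representation_def alg_hom_def mod_hom_def[of R A] End_alg_simps PiE_def)

text \<open>Conjugation turns products into products because the inner composite \<open>V \<circ> U\<close> cancels. Stating
  this for a pair of maps, rather than for an isomorphism and its inverse, lets the two maps exchange
  roles later.\<close>

lemma transport_rep_representation:
  assumes A: "nonunital_algebra R A" and \<pi>: "is_representation R A M \<pi>" and N: "module R N"
    and U: "U \<in> mod_hom R M N" and V: "V \<in> mod_hom R N M"
    and VU: "\<And>m. m \<in> carrier M \<Longrightarrow> V (U m) = m"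
  shows "is_representation R A N (transport_rep A N U V \<pi>)"
proof -
  interpret A: nonunital_algebra R A by fact
  interpret N: module R N by fact
  note pi_end = is_representationD(4)[OF \<pi>]
  have pi_eq: "\<pi> (x \<oplus>\<^bsub>A\<^esub> y) = (\<lambda>m\<in>carrier M. \<pi> x m \<oplus>\<^bsub>M\<^esub> \<pi> y m)"
    "\<pi> (x \<otimes>\<^bsub>A\<^esub> y) = compose (carrier M) (\<pi> x) (\<pi> y)"
    if "x \<in> carrier A" "y \<in> carrier A" for x y
    using is_representationD(2)[OF \<pi>] that by (auto simp: alg_hom_def mod_hom_def[of R A] End_alg_simps)
  have pi_smult: "\<pi> (a \<odot>\<^bsub>A\<^esub> x) = (\<lambda>m\<in>carrier M. a \<odot>\<^bsub>M\<^esub> \<pi> x m)"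
    if "a \<in> carrier R" "x \<in> carrier A" for a x
    using is_representationD(2)[OF \<pi>] that by (auto simp: alg_hom_def mod_hom_def[of R A] End_alg_simps)
  let ?T = "transport_rep A N U V \<pi>"
  have T: "?T a \<in> mod_hom R N N" if "a \<in> carrier A" for a
    using that pi_end[OF that]
    by (intro mod_homI) (auto simp: transport_rep_def mod_homD[OF U] mod_homD[OF V] mod_homD[OF pi_end])
  have "?T \<in> alg_hom R A (End_alg R N)"
    unfolding alg_hom_def
  proof (intro CollectI conjI mod_homI ballI)
    show "?T \<in> carrier A \<rightarrow>\<^sub>E carrier (End_alg R N)"
      using T by (auto simp: End_alg_simps) (simp add: transport_rep_def)
  next
    fix x y assume xy: "x \<in> carrier A" "y \<in> carrier A"
    then show "?T (x \<oplus>\<^bsub>A\<^esub> y) = ?T x \<oplus>\<^bsub>End_alg R N\<^esub> ?T y"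
      by (auto simp: transport_rep_def End_alg_simps pi_eq fun_eq_iff restrict_def
          mod_homD[OF U] mod_homD[OF V] mod_homD[OF pi_end])
    show "?T (x \<otimes>\<^bsub>A\<^esub> y) = ?T x \<otimes>\<^bsub>End_alg R N\<^esub> ?T y"
      using xy by (auto simp: transport_rep_def End_alg_simps pi_eq fun_eq_iff restrict_def compose_def
          mod_homD[OF U] mod_homD[OF V] mod_homD[OF pi_end] VU A.m_closed)
  next
    fix a x assume "a \<in> carrier R" "x \<in> carrier A"
    then show "?T (a \<odot>\<^bsub>A\<^esub> x) = a \<odot>\<^bsub>End_alg R N\<^esub> ?T x"
      by (auto simp: transport_rep_def End_alg_simps pi_smult fun_eq_iff restrict_def
          mod_homD[OF U] mod_homD[OF V] mod_homD[OF pi_end])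
  qed
  with N show ?thesis by (simp add: is_representation_def)
qed

section \<open>The standard basis of the finitely supported functions\<close>

lemma finsupp_module_simps:
  "f \<in> carrier (finsupp_module R X) \<longleftrightarrow> f \<in> X \<rightarrow>\<^sub>E carrier R \<and> finite {x \<in> X. f x \<noteq> \<zero>\<^bsub>R\<^esub>}"
  "\<zero>\<^bsub>finsupp_module R X\<^esub> = (\<lambda>x\<in>X. \<zero>\<^bsub>R\<^esub>)"
  "f \<oplus>\<^bsub>finsupp_module R X\<^esub> g = (\<lambda>x\<in>X. f x \<oplus>\<^bsub>R\<^esub> g x)"
  "a \<odot>\<^bsub>finsupp_module R X\<^esub> f = (\<lambda>x\<in>X. a \<otimes>\<^bsub>R\<^esub> f x)"
  by (auto simp: finsupp_module_def)

lemma finsupp_moduleD: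
  assumes "f \<in> carrier (finsupp_module R X)"
  shows "x \<in> X \<Longrightarrow> f x \<in> carrier R" and "finite {x \<in> X. f x \<noteq> \<zero>\<^bsub>R\<^esub>}"
    and "f \<in> extensional X"
  using assms by (auto simp: finsupp_module_simps PiE_def)

lemma finsupp_module_eqI:
  assumes "f \<in> carrier (finsupp_module R X)" "g \<in> carrier (finsupp_module R X)"
    and "\<And>x. x \<in> X \<Longrightarrow> f x = g x"
  shows "f = g"
  using extensionalityI[OF finsupp_moduleD(3)[OF assms(1)] finsupp_moduleD(3)[OF assms(2)]] assms(3) by blast

lemma finsupp_module_is_module:
  assumes "cring R"
  shows "module R (finsupp_module R X)"
proof -
  interpret R: cring R by fact
  let ?N = "finsupp_module R X"
  have add: "f \<oplus>\<^bsub>?N\<^esub> g \<in> carrier ?N" if "f \<in> carrier ?N" "g \<in> carrier ?N" for f g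
  proof -
    have "{x \<in> X. (f \<oplus>\<^bsub>?N\<^esub> g) x \<noteq> \<zero>\<^bsub>R\<^esub>} \<subseteq> {x \<in> X. f x \<noteq> \<zero>\<^bsub>R\<^esub>} \<union> {x \<in> X. g x \<noteq> \<zero>\<^bsub>R\<^esub>}"
      by (auto simp: finsupp_module_simps)
    from finite_subset[OF this] that show ?thesis
      by (auto simp: finsupp_module_simps(1)) (auto simp: finsupp_module_simps)
  qed
  have smult: "a \<odot>\<^bsub>?N\<^esub> f \<in> carrier ?N" if "a \<in> carrier R" "f \<in> carrier ?N" for a f
  proof -
    have "{x \<in> X. (a \<odot>\<^bsub>?N\<^esub> f) x \<noteq> \<zero>\<^bsub>R\<^esub>} \<subseteq> {x \<in> X. f x \<noteq> \<zero>\<^bsub>R\<^esub>}"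
      using that by (auto simp: finsupp_module_simps)
    from finite_subset[OF this] that show ?thesis
      by (auto simp: finsupp_module_simps(1)) (auto simp: finsupp_module_simps)
  qed
  have zero: "\<zero>\<^bsub>?N\<^esub> \<in> carrier ?N" by (auto simp: finsupp_module_simps)
  note eqI = finsupp_module_eqI[where R = R and X = X]
  note val = finsupp_moduleD(1)[where R = R and X = X] finsupp_module_simps(2-4)
  show ?thesis
  proof (rule moduleI[OF assms abelian_groupI smult])
    fix f assume f: "f \<in> carrier ?N"
    \<comment> \<open>As for endomorphisms, \<open>-1 \<cdot> f\<close> is the inverse, so that finiteness of its support is already known.\<close>
    show "\<exists>g\<in>carrier ?N. g \<oplus>\<^bsub>?N\<^esub> f = \<zero>\<^bsub>?N\<^esub>"
    proof
      show m: "(\<ominus>\<^bsub>R\<^esub> \<one>\<^bsub>R\<^esub>) \<odot>\<^bsub>?N\<^esub> f \<in> carrier ?N" using f by (intro smult) auto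
      show "(\<ominus>\<^bsub>R\<^esub> \<one>\<^bsub>R\<^esub>) \<odot>\<^bsub>?N\<^esub> f \<oplus>\<^bsub>?N\<^esub> f = \<zero>\<^bsub>?N\<^esub>"
        by (rule eqI[OF add[OF m f] zero]) (use f in \<open>auto simp: val R.l_minus R.l_neg\<close>)
    qed
  next
    fix f g h assume fgh: "f \<in> carrier ?N" "g \<in> carrier ?N" "h \<in> carrier ?N"
    show "f \<oplus>\<^bsub>?N\<^esub> g \<oplus>\<^bsub>?N\<^esub> h = f \<oplus>\<^bsub>?N\<^esub> (g \<oplus>\<^bsub>?N\<^esub> h)"
      using fgh by (intro eqI add) (auto simp: val R.a_assoc)
  next
    fix f g assume fg: "f \<in> carrier ?N" "g \<in> carrier ?N"
    show "f \<oplus>\<^bsub>?N\<^esub> g = g \<oplus>\<^bsub>?N\<^esub> f"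
      using fg by (intro eqI add) (auto simp: val R.a_comm)
  next
    fix f assume f: "f \<in> carrier ?N"
    show "\<zero>\<^bsub>?N\<^esub> \<oplus>\<^bsub>?N\<^esub> f = f" using f by (intro eqI add zero) (auto simp: val)
    show "\<one>\<^bsub>R\<^esub> \<odot>\<^bsub>?N\<^esub> f = f" using f by (intro eqI smult) (auto simp: val)
  next
    fix a b f assume "a \<in> carrier R" "b \<in> carrier R" "f \<in> carrier ?N"
    then show "(a \<oplus>\<^bsub>R\<^esub> b) \<odot>\<^bsub>?N\<^esub> f = a \<odot>\<^bsub>?N\<^esub> f \<oplus>\<^bsub>?N\<^esub> b \<odot>\<^bsub>?N\<^esub> f"
      and "(a \<otimes>\<^bsub>R\<^esub> b) \<odot>\<^bsub>?N\<^esub> f = a \<odot>\<^bsub>?N\<^esub> (b \<odot>\<^bsub>?N\<^esub> f)"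
      by (intro eqI smult add; auto simp: val R.l_distr R.m_assoc)+
  next
    fix a f g assume "a \<in> carrier R" "f \<in> carrier ?N" "g \<in> carrier ?N"
    then show "a \<odot>\<^bsub>?N\<^esub> (f \<oplus>\<^bsub>?N\<^esub> g) = a \<odot>\<^bsub>?N\<^esub> f \<oplus>\<^bsub>?N\<^esub> a \<odot>\<^bsub>?N\<^esub> g"
      by (intro eqI smult add) (auto simp: val R.r_distr)
  qed (fact add zero)+
qed

definition std_basis :: "('r, 'c) ring_scheme \<Rightarrow> 'x set \<Rightarrow> 'x \<Rightarrow> 'x \<Rightarrow> 'r"
  where "std_basis R X x = (\<lambda>y\<in>X. if y = x then \<one>\<^bsub>R\<^esub> else \<zero>\<^bsub>R\<^esub>)"

lemma std_basis_closed:
  assumes "cring R"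
  shows "std_basis R X x \<in> carrier (finsupp_module R X)"
proof -
  interpret R: cring R by fact
  have "{y \<in> X. std_basis R X x y \<noteq> \<zero>\<^bsub>R\<^esub>} \<subseteq> {x}" by (auto simp: std_basis_def)
  from finite_subset[OF this] show ?thesis
    by (auto simp: finsupp_module_simps(1)) (auto simp: std_basis_def)
qed

text \<open>A finitely supported function is built from zero by adding one multiple of an indicator function
  per point of its support; the proof is by induction on a finite set that contains the support.\<close>

lemma mod_hom_eq_on_std_basis:
  assumes R: "cring R" and M: "module R M"
    and f: "f \<in> mod_hom R (finsupp_module R X) M" and g: "g \<in> mod_hom R (finsupp_module R X) M"
    and eq: "\<And>x. x \<in> X \<Longrightarrow> f (std_basis R X x) = g (std_basis R X x)"
  shows "f = g"
proof (rule mod_hom_eqI[OF f g])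
  let ?N = "finsupp_module R X"
  interpret N: module R ?N by (rule finsupp_module_is_module[OF R])
  interpret M: module R M by fact
  fix c assume c: "c \<in> carrier ?N"
  have "f c = g c" if "finite F" "{x \<in> X. c x \<noteq> \<zero>\<^bsub>R\<^esub>} \<subseteq> F" "c \<in> carrier ?N" for F c
    using that
  proof (induction F arbitrary: c rule: finite_induct)
    case empty
    then have "c = \<zero>\<^bsub>?N\<^esub>"
      using N.M.zero_closed by (intro finsupp_module_eqI[of _ R X]) (auto simp: finsupp_module_simps(2))
    then show ?case by (simp add: mod_hom_zero[OF N.module_axioms M f] mod_hom_zero[OF N.module_axioms M g])
  next
    case (insert x F)
    show ?case
    proof (cases "x \<in> X")
      case False
      then show ?thesis using insert.prems by (intro insert.IH) auto
    next
      case True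
      define d where "d = c(x := \<zero>\<^bsub>R\<^esub>)"
      have dF: "{y \<in> X. d y \<noteq> \<zero>\<^bsub>R\<^esub>} \<subseteq> F"
        using insert.prems(1) by (auto simp: d_def)
      have d: "d \<in> carrier ?N"
        using insert.prems(2) finite_subset[OF dF insert.hyps(1)] True
        by (auto simp: finsupp_module_simps(1) d_def PiE_def extensional_def)
      have cx: "c x \<in> carrier R" using insert.prems(2) True by (rule finsupp_moduleD)
      note sb = std_basis_closed[OF R, of X x]
      have c: "c = d \<oplus>\<^bsub>?N\<^esub> c x \<odot>\<^bsub>?N\<^esub> std_basis R X x"
      proof (rule finsupp_module_eqI[OF insert.prems(2)])
        show "d \<oplus>\<^bsub>?N\<^esub> c x \<odot>\<^bsub>?N\<^esub> std_basis R X x \<in> carrier ?N"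
          using d cx sb by blast
        show "c y = (d \<oplus>\<^bsub>?N\<^esub> c x \<odot>\<^bsub>?N\<^esub> std_basis R X x) y" if "y \<in> X" for y
          using that cx finsupp_moduleD(1)[OF insert.prems(2) that]
          by (simp add: finsupp_module_simps(3,4) d_def std_basis_def)
      qed
      have "h c = h d \<oplus>\<^bsub>M\<^esub> c x \<odot>\<^bsub>M\<^esub> h (std_basis R X x)" if "h \<in> mod_hom R ?N M" for h
        by (subst c) (use d cx sb in \<open>simp add: mod_homD(4,5)[OF that]\<close>)
      then show ?thesis
        using f g insert.IH[OF dF d] eq[OF True] by metis
    qed
  qed
  with c show "f c = g c" using finsupp_moduleD(2) by blast
qed

definition lin_comb ::
  "('r, 'c) ring_scheme \<Rightarrow> ('r, 'm, 'd) module_scheme \<Rightarrow> 'x set \<Rightarrow> ('x \<Rightarrow> 'm) \<Rightarrow> ('x \<Rightarrow> 'r) \<Rightarrow> 'm"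
  where "lin_comb R M X b = (\<lambda>c\<in>carrier (finsupp_module R X).
    \<Oplus>\<^bsub>M\<^esub>x\<in>{x \<in> X. c x \<noteq> \<zero>\<^bsub>R\<^esub>}. c x \<odot>\<^bsub>M\<^esub> b x)"

text \<open>Summing over a common finite set is what makes additivity provable: the support of a sum of
  functions can be smaller than the union of the supports.\<close>

lemma lin_comb_superset:
  assumes M: "module R M" and b: "b \<in> X \<rightarrow> carrier M" and c: "c \<in> carrier (finsupp_module R X)"
    and F: "finite F" "{x \<in> X. c x \<noteq> \<zero>\<^bsub>R\<^esub>} \<subseteq> F" "F \<subseteq> X"
  shows "lin_comb R M X b c = (\<Oplus>\<^bsub>M\<^esub>x\<in>F. c x \<odot>\<^bsub>M\<^esub> b x)"
proof -
  interpret M: module R M by fact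
  have "(\<Oplus>\<^bsub>M\<^esub>x\<in>{x \<in> X. c x \<noteq> \<zero>\<^bsub>R\<^esub>}. c x \<odot>\<^bsub>M\<^esub> b x) = (\<Oplus>\<^bsub>M\<^esub>x\<in>F. c x \<odot>\<^bsub>M\<^esub> b x)"
    by (rule M.M.add.finprod_mono_neutral_cong_left)
      (use F b finsupp_moduleD(1)[OF c] in \<open>auto simp: Pi_def subset_iff\<close>)
  then show ?thesis using c by (simp add: lin_comb_def)
qed

lemma lin_comb_hom:
  assumes M: "module R M" and b: "b \<in> X \<rightarrow> carrier M"
  shows "lin_comb R M X b \<in> mod_hom R (finsupp_module R X) M"
proof (rule mod_homI)
  interpret M: module R M by fact
  have R: "cring R" ..
  let ?N = "finsupp_module R X"
  interpret N: module R ?N by (rule finsupp_module_is_module[OF R])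
  note sup = lin_comb_superset[OF M b]
  show "lin_comb R M X b \<in> carrier ?N \<rightarrow>\<^sub>E carrier M"
    using b by (auto simp: lin_comb_def finsupp_module_simps(1) Pi_def intro!: M.M.finsum_closed)
  {
    fix c d assume c: "c \<in> carrier ?N" and d: "d \<in> carrier ?N"
    define F where "F = {x \<in> X. c x \<noteq> \<zero>\<^bsub>R\<^esub>} \<union> {x \<in> X. d x \<noteq> \<zero>\<^bsub>R\<^esub>}"
    have F: "finite F" "F \<subseteq> X" using c d by (auto simp: F_def finsupp_moduleD)
    have "lin_comb R M X b (c \<oplus>\<^bsub>?N\<^esub> d) = (\<Oplus>\<^bsub>M\<^esub>x\<in>F. (c \<oplus>\<^bsub>?N\<^esub> d) x \<odot>\<^bsub>M\<^esub> b x)"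
      by (rule sup) (use c d F N.M.a_closed[OF c d] in \<open>auto simp: F_def finsupp_module_simps(3)\<close>)
    also have "\<dots> = (\<Oplus>\<^bsub>M\<^esub>x\<in>F. c x \<odot>\<^bsub>M\<^esub> b x \<oplus>\<^bsub>M\<^esub> d x \<odot>\<^bsub>M\<^esub> b x)"
      using F b c d by (intro M.M.finsum_cong')
        (auto simp: finsupp_module_simps(3) M.smult_l_distr finsupp_moduleD subset_iff Pi_def)
    also have "\<dots> = (\<Oplus>\<^bsub>M\<^esub>x\<in>F. c x \<odot>\<^bsub>M\<^esub> b x) \<oplus>\<^bsub>M\<^esub> (\<Oplus>\<^bsub>M\<^esub>x\<in>F. d x \<odot>\<^bsub>M\<^esub> b x)"
      using F b c d by (intro M.M.finsum_addf) (auto simp: finsupp_moduleD subset_iff Pi_def)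
    also have "(\<Oplus>\<^bsub>M\<^esub>x\<in>F. c x \<odot>\<^bsub>M\<^esub> b x) = lin_comb R M X b c"
      by (rule sup[symmetric]) (use c F in \<open>auto simp: F_def\<close>)
    also have "(\<Oplus>\<^bsub>M\<^esub>x\<in>F. d x \<odot>\<^bsub>M\<^esub> b x) = lin_comb R M X b d"
      by (rule sup[symmetric]) (use d F in \<open>auto simp: F_def\<close>)
    finally show "lin_comb R M X b (c \<oplus>\<^bsub>?N\<^esub> d) = lin_comb R M X b c \<oplus>\<^bsub>M\<^esub> lin_comb R M X b d" .
  next
    fix a c assume a: "a \<in> carrier R" and c: "c \<in> carrier ?N"
    define F where "F = {x \<in> X. c x \<noteq> \<zero>\<^bsub>R\<^esub>}"
    have F: "finite F" "F \<subseteq> X" using c by (auto simp: F_def finsupp_moduleD)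
    have "lin_comb R M X b (a \<odot>\<^bsub>?N\<^esub> c) = (\<Oplus>\<^bsub>M\<^esub>x\<in>F. (a \<odot>\<^bsub>?N\<^esub> c) x \<odot>\<^bsub>M\<^esub> b x)"
      by (rule sup) (use a c F N.smult_closed[OF a c] in \<open>auto simp: F_def finsupp_module_simps(4)\<close>)
    also have "\<dots> = (\<Oplus>\<^bsub>M\<^esub>x\<in>F. a \<odot>\<^bsub>M\<^esub> (c x \<odot>\<^bsub>M\<^esub> b x))"
      using F b a c by (intro M.M.finsum_cong')
        (auto simp: finsupp_module_simps(4) M.smult_assoc1 finsupp_moduleD subset_iff Pi_def)
    also have "\<dots> = a \<odot>\<^bsub>M\<^esub> (\<Oplus>\<^bsub>M\<^esub>x\<in>F. c x \<odot>\<^bsub>M\<^esub> b x)"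
      using F b a c by (intro M.finsum_smult_ldistr[symmetric]) (auto simp: finsupp_moduleD subset_iff Pi_def)
    also have "(\<Oplus>\<^bsub>M\<^esub>x\<in>F. c x \<odot>\<^bsub>M\<^esub> b x) = lin_comb R M X b c"
      by (rule sup[symmetric]) (use c F in \<open>auto simp: F_def\<close>)
    finally show "lin_comb R M X b (a \<odot>\<^bsub>?N\<^esub> c) = a \<odot>\<^bsub>M\<^esub> lin_comb R M X b c" .
  }
qed

text \<open>Over the zero ring the indicator function vanishes and \<open>{x}\<close> strictly contains its support.
  Summing over \<open>{x}\<close> treats this case together with the others.\<close>

lemma lin_comb_std_basis:
  assumes M: "module R M" and b: "b \<in> X \<rightarrow> carrier M" and x: "x \<in> X"
  shows "lin_comb R M X b (std_basis R X x) = b x"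
proof -
  interpret M: module R M by fact
  have R: "cring R" ..
  have "lin_comb R M X b (std_basis R X x) = (\<Oplus>\<^bsub>M\<^esub>y\<in>{x}. std_basis R X x y \<odot>\<^bsub>M\<^esub> b y)"
    by (rule lin_comb_superset[OF M b std_basis_closed[OF R]]) (use x in \<open>auto simp: std_basis_def\<close>)
  also have "\<dots> = b x" using x b by (auto simp: std_basis_def M.M.add.finprod_insert Pi_def)
  finally show ?thesis .
qed

lemma lin_comb_iso:
  assumes "free_module_with_basis R M X b"
  shows "lin_comb R M X b \<in> mod_iso R (finsupp_module R X) M"
proof -
  have M: "module R M" and b: "b \<in> X \<rightarrow> carrier M"
    and ex: "\<And>m. m \<in> carrier M \<Longrightarrow> \<exists>!c. c \<in> carrier (finsupp_module R X) \<and> m = lin_comb R M X b c"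
    using assms unfolding free_module_with_basis_def lin_comb_def by (auto cong: conj_cong)
  note hom = lin_comb_hom[OF M b]
  have "bij_betw (lin_comb R M X b) (carrier (finsupp_module R X)) (carrier M)"
    unfolding bij_betw_def inj_on_def using ex mod_homD(3)[OF hom] by blast
  with hom show ?thesis by (simp add: mod_iso_def)
qed

lemma mod_iso_inverse:
  assumes M: "module R M" and V: "V \<in> mod_iso R M N"
  defines "U \<equiv> \<lambda>n\<in>carrier N. inv_into (carrier M) V n"
  shows "U \<in> mod_iso R N M" and "m \<in> carrier M \<Longrightarrow> U (V m) = m" and "n \<in> carrier N \<Longrightarrow> V (U n) = n"
proof -
  interpret M: module R M by fact
  have hom: "V \<in> mod_hom R M N" and bij: "bij_betw V (carrier M) (carrier N)"
    using V by (auto simp: mod_iso_def)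
  show UV: "U (V m) = m" if "m \<in> carrier M" for m
    using that bij mod_homD(3)[OF hom that] by (simp add: U_def bij_betw_inv_into_left)
  show VU: "V (U n) = n" if "n \<in> carrier N" for n
    using that bij by (simp add: U_def bij_betw_inv_into_right)
  have bijU: "bij_betw U (carrier N) (carrier M)"
    using bij_betw_inv_into[OF bij] unfolding U_def by (simp cong: bij_betw_cong)
  then have Ucl: "U n \<in> carrier M" if "n \<in> carrier N" for n
    using that by (auto simp: bij_betw_def)
  have "U \<in> mod_hom R N M"
  proof (rule mod_homI)
    show "U \<in> carrier N \<rightarrow>\<^sub>E carrier M" using Ucl by (auto simp: U_def)
    fix x y assume "x \<in> carrier N" "y \<in> carrier N"
    then show "U (x \<oplus>\<^bsub>N\<^esub> y) = U x \<oplus>\<^bsub>M\<^esub> U y"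
      using UV[of "U x \<oplus>\<^bsub>M\<^esub> U y"] by (simp add: mod_homD[OF hom] Ucl VU)
  next
    fix a x assume "a \<in> carrier R" "x \<in> carrier N"
    then show "U (a \<odot>\<^bsub>N\<^esub> x) = a \<odot>\<^bsub>M\<^esub> U x"
      using UV[of "a \<odot>\<^bsub>M\<^esub> U x"] by (simp add: mod_homD[OF hom] Ucl VU)
  qed
  with bijU show "U \<in> mod_iso R N M" by (simp add: mod_iso_def)
qed

section \<open>Pullback along partial injections\<close>

text \<open>The operator on functions induced by a partial map \<open>g\<close> with domain \<open>Y\<close>. Injectivity of \<open>g\<close>
  keeps supports finite.\<close>

definition pullback ::
  "('r, 'c) ring_scheme \<Rightarrow> 'x set \<Rightarrow> 'x set \<Rightarrow> ('x \<Rightarrow> 'x) \<Rightarrow> ('x \<Rightarrow> 'r) \<Rightarrow> 'x \<Rightarrow> 'r"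
  where "pullback R X Y g = (\<lambda>f\<in>carrier (finsupp_module R X).
    \<lambda>x\<in>X. if x \<in> Y then f (g x) else \<zero>\<^bsub>R\<^esub>)"

lemma pullback_hom:
  assumes R: "cring R" and g: "g \<in> Y \<rightarrow> X" and inj: "inj_on g Y"
  shows "pullback R X Y g \<in> mod_hom R (finsupp_module R X) (finsupp_module R X)"
proof (rule mod_homI)
  interpret R: cring R by fact
  let ?N = "finsupp_module R X"
  interpret N: module R ?N by (rule finsupp_module_is_module[OF R])
  have cl: "pullback R X Y g f \<in> carrier ?N" if f: "f \<in> carrier ?N" for f
  proof -
    have "finite (g -` {x \<in> X. f x \<noteq> \<zero>\<^bsub>R\<^esub>} \<inter> Y)"
      by (rule finite_vimage_IntI[OF finsupp_moduleD(2)[OF f] inj])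
    moreover have "{x \<in> X. pullback R X Y g f x \<noteq> \<zero>\<^bsub>R\<^esub>} \<subseteq> g -` {x \<in> X. f x \<noteq> \<zero>\<^bsub>R\<^esub>} \<inter> Y"
      using f g by (auto simp: pullback_def split: if_splits)
    ultimately have "finite {x \<in> X. pullback R X Y g f x \<noteq> \<zero>\<^bsub>R\<^esub>}" by (rule rev_finite_subset)
    moreover have "pullback R X Y g f \<in> X \<rightarrow>\<^sub>E carrier R"
      using f g finsupp_moduleD(1)[OF f] by (auto simp: pullback_def Pi_def)
    ultimately show ?thesis by (simp add: finsupp_module_simps(1))
  qed
  then show "pullback R X Y g \<in> carrier ?N \<rightarrow>\<^sub>E carrier ?N"
    by (auto simp: pullback_def)
  show "pullback R X Y g (f \<oplus>\<^bsub>?N\<^esub> h) = pullback R X Y g f \<oplus>\<^bsub>?N\<^esub> pullback R X Y g h"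
    if "f \<in> carrier ?N" "h \<in> carrier ?N" for f h
  proof (rule finsupp_module_eqI[of _ R X])
    show "pullback R X Y g (f \<oplus>\<^bsub>?N\<^esub> h) x = (pullback R X Y g f \<oplus>\<^bsub>?N\<^esub> pullback R X Y g h) x" if "x \<in> X" for x
      using \<open>f \<in> carrier ?N\<close> \<open>h \<in> carrier ?N\<close> that g N.M.a_closed[of f h]
      by (auto simp: pullback_def finsupp_module_simps(3) Pi_def)
  qed (use that cl in auto)
  show "pullback R X Y g (a \<odot>\<^bsub>?N\<^esub> f) = a \<odot>\<^bsub>?N\<^esub> pullback R X Y g f"
    if "a \<in> carrier R" "f \<in> carrier ?N" for a f
  proof (rule finsupp_module_eqI[of _ R X])
    show "pullback R X Y g (a \<odot>\<^bsub>?N\<^esub> f) x = (a \<odot>\<^bsub>?N\<^esub> pullback R X Y g f) x" if "x \<in> X" for x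
      using \<open>a \<in> carrier R\<close> \<open>f \<in> carrier ?N\<close> that g N.smult_closed[of a f]
      by (auto simp: pullback_def finsupp_module_simps(4) Pi_def)
  qed (use that cl in auto)
qed

lemma pullback_cong:
  assumes "Y = Y'" "\<And>x. \<lbrakk>x \<in> X; x \<in> Y'\<rbrakk> \<Longrightarrow> g x = g' x"
  shows "pullback R X Y g = pullback R X Y' g'"
  using assms by (auto simp: pullback_def fun_eq_iff restrict_def)

lemma pullback_compose:
  assumes R: "cring R" and Y: "Y \<subseteq> X" and g: "g \<in> Y \<rightarrow> X" and h: "h \<in> Z \<rightarrow> X" and inj: "inj_on h Z"
  shows "compose (carrier (finsupp_module R X)) (pullback R X Y g) (pullback R X Z h) =
    pullback R X {x \<in> Y. g x \<in> Z} (h \<circ> g)"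
proof -
  have "pullback R X Z h f \<in> carrier (finsupp_module R X)" if "f \<in> carrier (finsupp_module R X)" for f
    using mod_homD(3)[OF pullback_hom[OF R h inj] that] .
  then show ?thesis using g Y
    by (auto simp: fun_eq_iff compose_def restrict_def pullback_def Pi_def)
qed

lemma pullback_std_basis:
  assumes R: "cring R" and "Y \<subseteq> X" and "g \<in> Y \<rightarrow> X" and inj: "inj_on g Y"
  shows "y \<in> Y \<Longrightarrow> pullback R X Y g (std_basis R X (g y)) = std_basis R X y"
    and "x \<notin> g ` Y \<Longrightarrow> pullback R X Y g (std_basis R X x) = \<zero>\<^bsub>finsupp_module R X\<^esub>"
proof -
  note cl = std_basis_closed[OF R, of X]
  show "pullback R X Y g (std_basis R X (g y)) = std_basis R X y" if "y \<in> Y"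
    using that assms(2,3) cl[of "g y"]
    by (auto simp: pullback_def std_basis_def fun_eq_iff restrict_def Pi_def dest: inj_onD[OF inj])
  show "pullback R X Y g (std_basis R X x) = \<zero>\<^bsub>finsupp_module R X\<^esub>" if "x \<notin> g ` Y"
    using that assms(3) cl[of x]
    by (auto simp: pullback_def std_basis_def finsupp_module_simps(2) fun_eq_iff restrict_def Pi_def)
qed

text \<open>Inclusion-exclusion for characteristic functions. It gives the relation for \<open>p\<^bsub>A \<union> B\<^esub>\<close>, and
  for disjoint sets the additivity behind the relation for regular vertices.\<close>

lemma pullback_Un_Int:
  assumes R: "cring R" and "Y \<subseteq> X" "Z \<subseteq> X"
  shows "pullback R X (Y \<union> Z) id \<oplus>\<^bsub>End_alg R (finsupp_module R X)\<^esub> pullback R X (Y \<inter> Z) id =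
    pullback R X Y id \<oplus>\<^bsub>End_alg R (finsupp_module R X)\<^esub> pullback R X Z id"
proof -
  interpret R: cring R by fact
  show ?thesis
    by (auto simp: End_alg_simps finsupp_module_simps(3) pullback_def fun_eq_iff restrict_def finsupp_moduleD)
qed

lemma pullback_empty: "pullback R X {} g = \<zero>\<^bsub>End_alg R (finsupp_module R X)\<^esub>"
  by (auto simp: End_alg_simps finsupp_module_simps(2) pullback_def)

section \<open>Adding and removing the first edge of a path\<close>

lemma path_cons_simps [simp]:
  "path_tl (path_cons e x) = x"
  "first_edge (path_cons e x) = Some e"
  "path_src G (path_cons e x) = src G e"
  by (cases x; simp)+

lemma path_cons_tl: "first_edge x = Some e \<Longrightarrow> path_cons e (path_tl x) = x"
  by (cases x rule: first_edge.cases) auto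

lemma path_src_first_edge: "first_edge x = Some e \<Longrightarrow> path_src G x = src G e"
  by (cases x rule: first_edge.cases) auto

lemma all_nat_iff: "(\<forall>i. P i) \<longleftrightarrow> P 0 \<and> (\<forall>i. P (Suc i))"
  by (metis not0_implies_Suc)

lemma finite_path_Cons:
  "finite_path G (e # \<alpha>) \<longleftrightarrow> e \<in> edges G \<and> (\<alpha> = [] \<or> finite_path G \<alpha> \<and> src G (hd \<alpha>) \<in> rng G e)"
proof (cases \<alpha>)
  case (Cons f \<beta>)
  have "(\<forall>i. Suc i < length (e # \<alpha>) \<longrightarrow> src G ((e # \<alpha>) ! Suc i) \<in> rng G ((e # \<alpha>) ! i)) \<longleftrightarrow>
    src G f \<in> rng G e \<and> (\<forall>i. Suc i < length \<alpha> \<longrightarrow> src G (\<alpha> ! Suc i) \<in> rng G (\<alpha> ! i))"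
    unfolding Cons by (subst all_nat_iff) auto
  then show ?thesis by (auto simp: finite_path_def Cons)
qed (simp add: finite_path_def)

lemma path_cons_in_paths:
  "path_cons e x \<in> paths G \<longleftrightarrow> e \<in> edges G \<and> x \<in> paths G \<and> path_src G x \<in> rng G e"
proof (cases x)
  case (FinPath \<alpha> v)
  then show ?thesis
    by (cases \<alpha>) (auto simp: paths_def paths_fin_def paths_inf_def finite_path_Cons)
next
  case (InfPath \<omega>)
  have "(\<forall>i. (e ## \<omega>) !! i \<in> edges G) \<longleftrightarrow> e \<in> edges G \<and> (\<forall>i. \<omega> !! i \<in> edges G)"
    and "(\<forall>i. src G ((e ## \<omega>) !! Suc i) \<in> rng G ((e ## \<omega>) !! i)) \<longleftrightarrow>
      src G (shd \<omega>) \<in> rng G e \<and> (\<forall>i. src G (\<omega> !! Suc i) \<in> rng G (\<omega> !! i))"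
    by (subst all_nat_iff, simp)+
  with InfPath show ?thesis
    by (auto simp: paths_def paths_fin_def paths_inf_def)
qed

lemma src_set_subset: "src_set G A \<subseteq> paths G"
  and edge_set_subset: "edge_set G e \<subseteq> paths G"
  by (auto simp: src_set_def edge_set_def)

lemma path_cons_edge_set:
  assumes "e \<in> edges G"
  shows "path_cons e x \<in> edge_set G f \<longleftrightarrow> e = f \<and> x \<in> src_set G (rng G e)"
  using assms by (auto simp: edge_set_def src_set_def path_cons_in_paths)

lemma path_tl_src_set:
  assumes "x \<in> edge_set G e"
  shows "path_tl x \<in> src_set G (rng G e)"
proof -
  have "path_cons e (path_tl x) \<in> paths G" using assms by (auto simp: edge_set_def path_cons_tl)
  then show ?thesis by (auto simp: path_cons_in_paths src_set_def)
qed

lemma edge_set_cons_tl: "x \<in> edge_set G e \<Longrightarrow> path_cons e (path_tl x) = x"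
  by (simp add: edge_set_def path_cons_tl)

lemma edge_set_src: "x \<in> edge_set G e \<Longrightarrow> path_src G x = src G e"
  by (simp add: edge_set_def path_src_first_edge)

lemma inj_on_path_tl: "inj_on path_tl (edge_set G e)"
  by (rule inj_onI) (metis edge_set_cons_tl)

lemma inj_on_path_cons: "inj_on (path_cons e) Y"
  by (rule inj_onI) (metis path_cons_simps(1))

text \<open>A path of length zero ends in a sink, so a path that starts at a vertex emitting edges has
  a first edge.\<close>

lemma regular_src_set:
  assumes "{e \<in> edges G. src G e = v} \<noteq> {}"
  shows "src_set G {v} = (\<Union>e\<in>{e \<in> edges G. src G e = v}. edge_set G e)"
proof (intro subset_antisym subsetI)
  fix x assume x: "x \<in> src_set G {v}"
  show "x \<in> (\<Union>e\<in>{e \<in> edges G. src G e = v}. edge_set G e)"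
  proof (cases "first_edge x")
    case None
    then have "x = FinPath [] v" using x by (cases x rule: first_edge.cases) (auto simp: src_set_def)
    then have "v \<in> sinks G" using x by (auto simp: src_set_def paths_def paths_fin_def paths_inf_def finite_path_def)
    with assms show ?thesis by (auto simp: sinks_def)
  next
    case (Some e)
    then have "path_cons e (path_tl x) \<in> paths G" using x by (simp add: path_cons_tl src_set_def)
    with Some x show ?thesis
      by (auto simp: path_cons_in_paths edge_set_def src_set_def path_src_first_edge)
  qed
qed (auto simp: src_set_def edge_set_def path_src_first_edge)

section \<open>Operators on functions satisfying the Leavitt relations\<close>

definition p_op :: "('r, 'c) ring_scheme \<Rightarrow> ('v, 'e) ugraph \<Rightarrow> 'v set \<Rightarrow> (('v, 'e) path \<Rightarrow> 'r) \<Rightarrow> ('v, 'e) path \<Rightarrow> 'r"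
  where "p_op R G A = pullback R (paths G) (src_set G A) id"

definition s_op :: "('r, 'c) ring_scheme \<Rightarrow> ('v, 'e) ugraph \<Rightarrow> 'e \<Rightarrow> (('v, 'e) path \<Rightarrow> 'r) \<Rightarrow> ('v, 'e) path \<Rightarrow> 'r"
  where "s_op R G e = pullback R (paths G) (edge_set G e) path_tl"

definition s_star_op :: "('r, 'c) ring_scheme \<Rightarrow> ('v, 'e) ugraph \<Rightarrow> 'e \<Rightarrow> (('v, 'e) path \<Rightarrow> 'r) \<Rightarrow> ('v, 'e) path \<Rightarrow> 'r"
  where "s_star_op R G e = pullback R (paths G) (src_set G (rng G e)) (path_cons e)"

lemma path_maps:
  shows "id \<in> src_set G A \<rightarrow> paths G" and "path_tl \<in> edge_set G e \<rightarrow> paths G"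
    and "e \<in> edges G \<Longrightarrow> path_cons e \<in> src_set G (rng G e) \<rightarrow> paths G"
  using path_tl_src_set src_set_subset by (fastforce simp: src_set_def path_cons_in_paths)+

lemma path_ops_closed:
  assumes R: "cring R"
  shows "p_op R G A \<in> mod_hom R (finsupp_module R (paths G)) (finsupp_module R (paths G))"
    and "s_op R G e \<in> mod_hom R (finsupp_module R (paths G)) (finsupp_module R (paths G))"
    and "e \<in> edges G \<Longrightarrow> s_star_op R G e \<in> mod_hom R (finsupp_module R (paths G)) (finsupp_module R (paths G))"
  unfolding p_op_def s_op_def s_star_op_def
  by (intro pullback_hom[OF R] path_maps inj_on_id inj_on_path_tl inj_on_path_cons; assumption?)+

text \<open>Removing the first edge \<open>e\<close> and putting it back changes nothing, so \<open>s\<^sub>e s\<^sub>e\<^sup>*\<close> is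
  multiplication by the characteristic function of the paths with first edge \<open>e\<close>.\<close>

lemma s_op_s_star_op:
  assumes R: "cring R" and e: "e \<in> edges G"
  shows "compose (carrier (finsupp_module R (paths G))) (s_op R G e) (s_star_op R G e) =
    pullback R (paths G) (edge_set G e) id"
  unfolding s_op_def s_star_op_def
    pullback_compose[OF R edge_set_subset path_maps(2) path_maps(3)[OF e] inj_on_path_cons]
  by (rule pullback_cong) (auto simp: path_tl_src_set edge_set_cons_tl)

text \<open>Paths with different first edges are different, so these projections add up to the
  projection for the union.\<close>

lemma finsum_pullback_edge_set:
  assumes R: "cring R" and F: "finite F" "F \<subseteq> edges G"
  defines "E \<equiv> End_alg R (finsupp_module R (paths G))"
  shows "(\<Oplus>\<^bsub>E\<^esub>e\<in>F. s_op R G e \<otimes>\<^bsub>E\<^esub> s_star_op R G e) = pullback R (paths G) (\<Union>e\<in>F. edge_set G e) id"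
proof -
  interpret E: nonunital_algebra R E
    unfolding E_def by (rule End_alg_is_algebra[OF finsupp_module_is_module[OF R]])
  have cl: "pullback R (paths G) Y id \<in> carrier E" if "Y \<subseteq> paths G" for Y
    unfolding E_def End_alg_simps using that by (intro pullback_hom[OF R]) auto
  have eq: "s_op R G e \<otimes>\<^bsub>E\<^esub> s_star_op R G e = pullback R (paths G) (edge_set G e) id" if "e \<in> edges G" for e
    unfolding E_def End_alg_simps by (rule s_op_s_star_op[OF R that])
  show ?thesis using F
  proof (induction F rule: finite_induct)
    case empty
    show ?case using E.M.finsum_empty by (simp add: pullback_empty E_def)
  next
    case (insert e F)
    let ?Y = "\<Union>e\<in>F. edge_set G e"
    have sub: "edge_set G e \<subseteq> paths G" "?Y \<subseteq> paths G"
      by (auto dest: subsetD[OF edge_set_subset])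
    have "edge_set G e \<inter> ?Y = {}" using insert.hyps by (auto simp: edge_set_def)
    then have Un: "pullback R (paths G) (edge_set G e \<union> ?Y) id =
      pullback R (paths G) (edge_set G e) id \<oplus>\<^bsub>E\<^esub> pullback R (paths G) ?Y id"
      using pullback_Un_Int[OF R sub] cl[of "edge_set G e \<union> ?Y"] sub
      by (simp add: E_def[symmetric] pullback_empty)
    have in_edges: "e \<in> edges G" "F \<subseteq> edges G" using insert.prems by auto
    have term_closed: "s_op R G f \<otimes>\<^bsub>E\<^esub> s_star_op R G f \<in> carrier E" if "f \<in> edges G" for f
      unfolding eq[OF that] by (rule cl[OF edge_set_subset])
    have "(\<Oplus>\<^bsub>E\<^esub>f\<in>insert e F. s_op R G f \<otimes>\<^bsub>E\<^esub> s_star_op R G f) =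
      s_op R G e \<otimes>\<^bsub>E\<^esub> s_star_op R G e \<oplus>\<^bsub>E\<^esub> (\<Oplus>\<^bsub>E\<^esub>f\<in>F. s_op R G f \<otimes>\<^bsub>E\<^esub> s_star_op R G f)"
      using insert.hyps in_edges term_closed by (intro E.M.finsum_insert) auto
    also have "\<dots> = pullback R (paths G) (edge_set G e \<union> ?Y) id"
      unfolding eq[OF in_edges(1)] insert.IH[OF in_edges(2)] Un ..
    finally show ?case by (simp only: UN_insert)
  qed
qed

text \<open>Each multiplicative relation says that a composite of two partial maps on paths equals another
  partial map; \<open>pullback_compose\<close> produces the composite and \<open>pullback_cong\<close> compares domains and
  values. The relation for a regular vertex \<open>v\<close> holds because the paths that start at \<open>v\<close> are
  partitioned by their first edge.\<close>

lemma path_ops_leavitt_family: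
  assumes R: "cring R" and G: "ultragraph G"
  shows "leavitt_family R G (End_alg R (finsupp_module R (paths G))) (p_op R G) (s_op R G) (s_star_op R G)"
proof -
  let ?N = "finsupp_module R (paths G)"
  let ?E = "End_alg R ?N"
  interpret E: nonunital_algebra R ?E
    by (rule End_alg_is_algebra[OF finsupp_module_is_module[OF R]])
  note closed = path_ops_closed[OF R, where G = G]
  note pcomp = pullback_compose[OF R]
  note ops = p_op_def s_op_def s_star_op_def
  show ?thesis
  proof unfold_locales
    fix B C
    show "p_op R G B \<otimes>\<^bsub>?E\<^esub> p_op R G C = p_op R G (B \<inter> C)"
      unfolding ops End_alg_simps pcomp[OF src_set_subset path_maps(1) path_maps(1) inj_on_id]
      by (rule pullback_cong) (auto simp: src_set_def)
    have un: "src_set G (B \<union> C) = src_set G B \<union> src_set G C" "src_set G (B \<inter> C) = src_set G B \<inter> src_set G C"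
      by (auto simp: src_set_def)
    have cl: "p_op R G A \<in> carrier ?E" for A using closed by (simp add: End_alg_simps)
    have "p_op R G (B \<union> C) \<oplus>\<^bsub>?E\<^esub> p_op R G (B \<inter> C) = p_op R G B \<oplus>\<^bsub>?E\<^esub> p_op R G C"
      unfolding p_op_def un by (rule pullback_Un_Int[OF R src_set_subset src_set_subset])
    then show "p_op R G (B \<union> C) = p_op R G B \<oplus>\<^bsub>?E\<^esub> p_op R G C \<ominus>\<^bsub>?E\<^esub> p_op R G (B \<inter> C)"
      by (metis E.M.add.inv_solve_right E.M.a_closed E.M.minus_eq cl)
  next
    show "p_op R G {} = \<zero>\<^bsub>?E\<^esub>" unfolding p_op_def by (simp add: src_set_def pullback_empty)
  next
    fix e assume e: "e \<in> edges G"
    show "p_op R G {src G e} \<otimes>\<^bsub>?E\<^esub> s_op R G e = s_op R G e"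
      unfolding ops End_alg_simps pcomp[OF src_set_subset path_maps(1,2) inj_on_path_tl]
      by (rule pullback_cong) (auto simp: edge_set_src src_set_def dest: subsetD[OF edge_set_subset])
    show "s_op R G e \<otimes>\<^bsub>?E\<^esub> p_op R G (rng G e) = s_op R G e"
      unfolding ops End_alg_simps pcomp[OF edge_set_subset path_maps(2,1) inj_on_id]
      by (rule pullback_cong) (auto simp: path_tl_src_set)
    show "p_op R G (rng G e) \<otimes>\<^bsub>?E\<^esub> s_star_op R G e = s_star_op R G e"
      unfolding ops End_alg_simps pcomp[OF src_set_subset path_maps(1) path_maps(3)[OF e] inj_on_path_cons]
      by (rule pullback_cong) auto
    show "s_star_op R G e \<otimes>\<^bsub>?E\<^esub> p_op R G {src G e} = s_star_op R G e"
      unfolding ops End_alg_simps pcomp[OF src_set_subset path_maps(3)[OF e] path_maps(1) inj_on_id]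
      by (rule pullback_cong) (use e in \<open>auto simp: src_set_def path_cons_in_paths\<close>)
    fix f
    show "s_star_op R G e \<otimes>\<^bsub>?E\<^esub> s_op R G f = (if e = f then p_op R G (rng G e) else \<zero>\<^bsub>?E\<^esub>)"
    proof -
      have "s_star_op R G e \<otimes>\<^bsub>?E\<^esub> s_op R G f =
        pullback R (paths G) {x \<in> src_set G (rng G e). path_cons e x \<in> edge_set G f} (path_tl \<circ> path_cons e)"
        unfolding ops End_alg_simps pcomp[OF src_set_subset path_maps(3)[OF e] path_maps(2) inj_on_path_tl] ..
      also have "\<dots> = (if e = f then p_op R G (rng G e) else \<zero>\<^bsub>?E\<^esub>)"
        by (auto simp: p_op_def pullback_empty path_cons_edge_set[OF e] intro!: pullback_cong)
      finally show ?thesis .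
    qed
  next
    fix v assume v: "v \<in> verts G" "{e \<in> edges G. src G e = v} \<noteq> {}" "finite {e \<in> edges G. src G e = v}"
    show "p_op R G {v} = (\<Oplus>\<^bsub>?E\<^esub>e\<in>{e \<in> edges G. src G e = v}. s_op R G e \<otimes>\<^bsub>?E\<^esub> s_star_op R G e)"
      by (subst finsum_pullback_edge_set[OF R v(3)])
        (auto simp: p_op_def regular_src_set[OF v(2)])
  qed (use closed in \<open>auto simp: End_alg_simps\<close>)
qed

text \<open>The bridge between the two representations: with \<open>b\<^sub>\<alpha>\<close> in place of \<open>\<delta> \<alpha>\<close> these are the
  formulas that describe the action on the free module.\<close>

lemma path_ops_std_basis:
  assumes R: "cring R" and x: "x \<in> paths G"
  defines "\<delta> \<equiv> std_basis R (paths G)" and "N \<equiv> finsupp_module R (paths G)"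
  shows "p_op R G A (\<delta> x) = (if path_src G x \<in> A then \<delta> x else \<zero>\<^bsub>N\<^esub>)"
    and "e \<in> edges G \<Longrightarrow> s_op R G e (\<delta> x) = (if path_src G x \<in> rng G e then \<delta> (path_cons e x) else \<zero>\<^bsub>N\<^esub>)"
    and "e \<in> edges G \<Longrightarrow> s_star_op R G e (\<delta> x) = (if first_edge x = Some e then \<delta> (path_tl x) else \<zero>\<^bsub>N\<^esub>)"
proof -
  note pb = pullback_std_basis[OF R, where X = "paths G"]
  show "p_op R G A (\<delta> x) = (if path_src G x \<in> A then \<delta> x else \<zero>\<^bsub>N\<^esub>)"
    using pb[OF src_set_subset path_maps(1) inj_on_id, of x A] x
    by (auto simp: p_op_def \<delta>_def N_def src_set_def)
  assume e: "e \<in> edges G"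
  show "s_op R G e (\<delta> x) = (if path_src G x \<in> rng G e then \<delta> (path_cons e x) else \<zero>\<^bsub>N\<^esub>)"
  proof (cases "path_src G x \<in> rng G e")
    case True
    then have "path_cons e x \<in> edge_set G e" using x e by (simp add: edge_set_def path_cons_in_paths)
    from pb(1)[OF edge_set_subset path_maps(2) inj_on_path_tl this] True show ?thesis
      by (simp add: s_op_def \<delta>_def)
  next
    case False
    then have "x \<notin> path_tl ` edge_set G e" using path_tl_src_set by (fastforce simp: src_set_def)
    from pb(2)[OF edge_set_subset path_maps(2) inj_on_path_tl this] False show ?thesis
      by (simp add: s_op_def \<delta>_def N_def)
  qed
  show "s_star_op R G e (\<delta> x) = (if first_edge x = Some e then \<delta> (path_tl x) else \<zero>\<^bsub>N\<^esub>)"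
  proof (cases "first_edge x = Some e")
    case True
    then have "x \<in> edge_set G e" using x by (simp add: edge_set_def)
    from pb(1)[OF src_set_subset path_maps(3)[OF e] inj_on_path_cons path_tl_src_set[OF this]] True show ?thesis
      by (simp add: s_star_op_def \<delta>_def path_cons_tl)
  next
    case False
    then have "x \<notin> path_cons e ` src_set G (rng G e)" by auto
    from pb(2)[OF src_set_subset path_maps(3)[OF e] inj_on_path_cons this] False show ?thesis
      by (simp add: s_star_op_def \<delta>_def N_def)
  qed
qed

section \<open>The representation on functions\<close>

lemma pullback_formula_iff:
  assumes "cring R" "g \<in> Y \<rightarrow> X" "inj_on g Y"
    and "T \<in> mod_hom R (finsupp_module R X) (finsupp_module R X)"
  shows "(\<forall>f\<in>carrier (finsupp_module R X). T f = (\<lambda>x\<in>X. if x \<in> Y then f (g x) else \<zero>\<^bsub>R\<^esub>)) \<longleftrightarrow>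
    T = pullback R X Y g" (is "?L \<longleftrightarrow> ?R")
proof
  assume ?L
  then show ?R by (intro mod_hom_eqI[OF assms(4) pullback_hom[OF assms(1-3)]]) (simp add: pullback_def)
qed (simp add: pullback_def)

lemma inv_into_edge_map:
  assumes "x \<in> edge_set G e"
  shows "inv_into (src_set G (rng G e)) (edge_map G e) x = path_tl x"
proof -
  have inj: "inj_on (edge_map G e) (src_set G (rng G e))"
    by (simp add: edge_map_def inj_on_path_cons)
  have "edge_map G e (path_tl x) = x"
    using path_tl_src_set[OF assms] edge_set_cons_tl[OF assms] by (simp add: edge_map_def)
  with inv_into_f_f[OF inj path_tl_src_set[OF assms]] show ?thesis by simp
qed

text \<open>The description of \<open>\<phi>\<close> with equations between operators in place of equations at every function,
  which is the form in which the universal property speaks about generators.\<close>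

definition path_ops_rep ::
  "('r, 'c) ring_scheme \<Rightarrow> ('v, 'e) ugraph
    \<Rightarrow> (('r, ('v, 'e) lpa_gen) alg_term set \<Rightarrow> (('v, 'e) path \<Rightarrow> 'r) \<Rightarrow> ('v, 'e) path \<Rightarrow> 'r) \<Rightarrow> bool"
  where "path_ops_rep R G \<phi> \<longleftrightarrow> is_representation R (leavitt R G) (finsupp_module R (paths G)) \<phi> \<and>
    (\<forall>A\<in>gen_verts G. \<phi> (lpa_p R G A) = p_op R G A) \<and>
    (\<forall>e\<in>edges G. \<phi> (lpa_s R G e) = s_op R G e) \<and>
    (\<forall>e\<in>edges G. \<phi> (lpa_s_star R G e) = s_star_op R G e)"

lemma ex1_path_ops_rep:
  assumes "cring R" "ultragraph G"
  shows "\<exists>!\<phi>. path_ops_rep R G \<phi>"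
  using leavitt_universal[OF path_ops_leavitt_family[OF assms]]
    finsupp_module_is_module[OF assms(1), of "paths G"]
  unfolding path_ops_rep_def is_representation_def by simp

lemma function_rep_eq:
  fixes R :: "('r, 'c) ring_scheme" and G :: "('v, 'e) ugraph"
  assumes R: "cring R" and G: "ultragraph G"
  shows "function_rep R G = (THE \<phi>. path_ops_rep R G \<phi>)"
  unfolding function_rep_def path_ops_rep_def
proof (intro arg_cong[where f = The] ext conj_cong refl ball_cong)
  let ?N = "finsupp_module R (paths G)"
  interpret L: leavitt_family R G "leavitt R G" "lpa_p R G" "lpa_s R G" "lpa_s_star R G"
    by (rule leavitt_leavitt_family[OF R G])
  fix \<phi> :: "('r, ('v, 'e) lpa_gen) alg_term set \<Rightarrow> (('v, 'e) path \<Rightarrow> 'r) \<Rightarrow> ('v, 'e) path \<Rightarrow> 'r"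
  assume "is_representation R (leavitt R G) ?N \<phi>"
  note End = is_representationD(4)[OF this]
  show "(\<forall>f\<in>carrier ?N. \<phi> (lpa_p R G A) f = (\<lambda>x\<in>paths G. if x \<in> src_set G A then f x else \<zero>\<^bsub>R\<^esub>)) \<longleftrightarrow>
    \<phi> (lpa_p R G A) = p_op R G A" if "A \<in> gen_verts G" for A
    using pullback_formula_iff[OF R path_maps(1) inj_on_id End[OF L.p_closed[OF that]], of A]
    by (simp add: p_op_def cong: if_cong)
  fix e assume e: "e \<in> edges G"
  show "(\<forall>f\<in>carrier ?N. \<phi> (lpa_s R G e) f = (\<lambda>x\<in>paths G. if x \<in> edge_set G e
      then f (inv_into (src_set G (rng G e)) (edge_map G e) x) else \<zero>\<^bsub>R\<^esub>)) \<longleftrightarrow>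
    \<phi> (lpa_s R G e) = s_op R G e"
    using pullback_formula_iff[OF R path_maps(2) inj_on_path_tl End[OF L.s_closed[OF e]], of e]
    by (simp add: s_op_def inv_into_edge_map cong: if_cong)
  show "(\<forall>f\<in>carrier ?N. \<phi> (lpa_s_star R G e) f = (\<lambda>x\<in>paths G. if x \<in> src_set G (rng G e)
      then f (edge_map G e x) else \<zero>\<^bsub>R\<^esub>)) \<longleftrightarrow>
    \<phi> (lpa_s_star R G e) = s_star_op R G e"
    using pullback_formula_iff[OF R path_maps(3)[OF e] inj_on_path_cons End[OF L.s_star_closed[OF e]]]
    by (simp add: s_star_op_def edge_map_def cong: if_cong)
qed simp_all

lemma function_rep_path_ops:
  assumes "cring R" "ultragraph G"
  shows "path_ops_rep R G (function_rep R G)"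
  unfolding function_rep_eq[OF assms] by (rule theI'[OF ex1_path_ops_rep[OF assms]])

section \<open>The representation on the free module and the equivalence\<close>

text \<open>The transported representation has the required values because \<open>U\<close> sends \<open>b \<alpha>\<close> to the indicator
  function of \<open>\<alpha>\<close>. Conversely a representation with these values, transported to functions, agrees with
  the path operators on indicator functions, so it is the representation on functions by the
  universal property, and transporting once more recovers it.\<close>

lemma basis_rep_eq_transport:
  assumes R: "cring R" and G: "ultragraph G" and M: "module R M"
    and V: "V \<in> mod_iso R (finsupp_module R (paths G)) M"
    and U: "U \<in> mod_iso R M (finsupp_module R (paths G))"
    and UV: "\<And>n. n \<in> carrier (finsupp_module R (paths G)) \<Longrightarrow> U (V n) = n"
    and VU: "\<And>m. m \<in> carrier M \<Longrightarrow> V (U m) = m"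
    and Vb: "\<And>x. x \<in> paths G \<Longrightarrow> V (std_basis R (paths G) x) = b x"
  shows "basis_rep R G M b = transport_rep (leavitt R G) M V U (function_rep R G)"
  unfolding basis_rep_def
proof (rule the_equality, safe)
  let ?L = "leavitt R G" and ?N = "finsupp_module R (paths G)" and ?\<delta> = "std_basis R (paths G)"
  let ?\<phi> = "function_rep R G"
  let ?\<pi> = "transport_rep ?L M V U ?\<phi>"
  have N: "module R ?N" by (rule finsupp_module_is_module[OF R])
  have Vh: "V \<in> mod_hom R ?N M" and Uh: "U \<in> mod_hom R M ?N" using U V by (auto simp: mod_iso_def)
  interpret L: leavitt_family R G ?L "lpa_p R G" "lpa_s R G" "lpa_s_star R G"
    by (rule leavitt_leavitt_family[OF R G])
  note \<phi> = function_rep_path_ops[OF R G]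
  note \<phi>_rep = \<phi>[unfolded path_ops_rep_def, THEN conjunct1]
  note \<delta>_closed = std_basis_closed[OF R, of "paths G"]
  have b_closed: "b x \<in> carrier M" if "x \<in> paths G" for x
    using mod_homD(3)[OF Vh \<delta>_closed, of x] Vb[OF that] by simp
  have Ub: "U (b x) = ?\<delta> x" if "x \<in> paths G" for x
    using UV[OF \<delta>_closed, of x] Vb[OF that] by simp
  have zero: "V \<zero>\<^bsub>?N\<^esub> = \<zero>\<^bsub>M\<^esub>" "U \<zero>\<^bsub>M\<^esub> = \<zero>\<^bsub>?N\<^esub>"
    by (rule mod_hom_zero[OF N M Vh] mod_hom_zero[OF M N Uh])+
  show "is_representation R ?L M ?\<pi>"
    by (rule transport_rep_representation[OF L.nonunital_algebra_axioms \<phi>_rep M Vh Uh]) (rule UV)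
  have tl: "path_tl x \<in> paths G" if "x \<in> paths G" "first_edge x = Some e" for x e
    using that path_maps(2)[of G e] by (auto simp: edge_set_def)
  have pi_b: "?\<pi> a (b x) = V (?\<phi> a (?\<delta> x))" if "a \<in> carrier ?L" "x \<in> paths G" for a x
    using that by (simp add: transport_rep_def b_closed Ub)
  fix x assume x: "x \<in> paths G"
  note opb = path_ops_std_basis[OF R x]
  show "?\<pi> (lpa_p R G A) (b x) = (if path_src G x \<in> A then b x else \<zero>\<^bsub>M\<^esub>)" if "A \<in> gen_verts G" for A
    using \<phi> that x by (simp add: pi_b L.p_closed path_ops_rep_def opb Vb zero)
  fix e assume e: "e \<in> edges G"
  show "?\<pi> (lpa_s R G e) (b x) = (if path_src G x \<in> rng G e then b (path_cons e x) else \<zero>\<^bsub>M\<^esub>)"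
    using \<phi> e x by (simp add: pi_b L.s_closed path_ops_rep_def opb Vb zero path_cons_in_paths)
  show "?\<pi> (lpa_s_star R G e) (b x) = (if first_edge x = Some e then b (path_tl x) else \<zero>\<^bsub>M\<^esub>)"
    using \<phi> e x by (simp add: pi_b L.s_star_closed path_ops_rep_def opb Vb zero tl)
next
  let ?L = "leavitt R G" and ?N = "finsupp_module R (paths G)" and ?\<delta> = "std_basis R (paths G)"
  let ?\<phi> = "function_rep R G"
  have N: "module R ?N" by (rule finsupp_module_is_module[OF R])
  have Vh: "V \<in> mod_hom R ?N M" and Uh: "U \<in> mod_hom R M ?N" using U V by (auto simp: mod_iso_def)
  interpret L: leavitt_family R G ?L "lpa_p R G" "lpa_s R G" "lpa_s_star R G"
    by (rule leavitt_leavitt_family[OF R G])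
  note \<delta>_closed = std_basis_closed[OF R, of "paths G"]
  have Ub: "U (b x) = ?\<delta> x" if "x \<in> paths G" for x
    using UV[OF \<delta>_closed, of x] Vb[OF that] by simp
  have zero: "U \<zero>\<^bsub>M\<^esub> = \<zero>\<^bsub>?N\<^esub>" by (rule mod_hom_zero; fact)
  have tl: "path_tl x \<in> paths G" if "x \<in> paths G" "first_edge x = Some e" for x e
    using that path_maps(2)[of G e] by (auto simp: edge_set_def)
  fix \<pi>
  assume \<pi>: "is_representation R ?L M \<pi>"
    and p: "\<forall>A\<in>gen_verts G. \<forall>x\<in>paths G.
      \<pi> (lpa_p R G A) (b x) = (if path_src G x \<in> A then b x else \<zero>\<^bsub>M\<^esub>)"
    and s: "\<forall>e\<in>edges G. \<forall>x\<in>paths G.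
      \<pi> (lpa_s R G e) (b x) = (if path_src G x \<in> rng G e then b (path_cons e x) else \<zero>\<^bsub>M\<^esub>)"
    and s_star: "\<forall>e\<in>edges G. \<forall>x\<in>paths G.
      \<pi> (lpa_s_star R G e) (b x) = (if first_edge x = Some e then b (path_tl x) else \<zero>\<^bsub>M\<^esub>)"
  let ?\<psi> = "transport_rep ?L ?N U V \<pi>"
  have \<psi>: "is_representation R ?L ?N ?\<psi>"
    by (rule transport_rep_representation[OF L.nonunital_algebra_axioms \<pi> N Uh Vh]) (rule VU)
  have psi_\<delta>: "?\<psi> a (?\<delta> x) = U (\<pi> a (b x))" if "a \<in> carrier ?L" "x \<in> paths G" for a x
    using that \<delta>_closed by (simp add: transport_rep_def Vb)
  have eqI: "?\<psi> a = T" if "a \<in> carrier ?L" "T \<in> mod_hom R ?N ?N"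
    "\<And>x. x \<in> paths G \<Longrightarrow> U (\<pi> a (b x)) = T (?\<delta> x)" for a T
    by (rule mod_hom_eq_on_std_basis[OF R N is_representationD(4)[OF \<psi> that(1)] that(2)])
      (simp add: psi_\<delta> that)
  have "path_ops_rep R G ?\<psi>"
    unfolding path_ops_rep_def
  proof (intro conjI \<psi> ballI)
    show "?\<psi> (lpa_p R G A) = p_op R G A" if "A \<in> gen_verts G" for A
      using that p by (intro eqI L.p_closed path_ops_closed[OF R])
        (auto simp: path_ops_std_basis[OF R] Ub zero)
    fix e assume e: "e \<in> edges G"
    show "?\<psi> (lpa_s R G e) = s_op R G e"
      using e s by (intro eqI L.s_closed path_ops_closed[OF R])
        (auto simp: path_ops_std_basis[OF R] Ub zero path_cons_in_paths)
    show "?\<psi> (lpa_s_star R G e) = s_star_op R G e"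
      using e s_star by (intro eqI L.s_star_closed path_ops_closed[OF R])
        (auto simp: path_ops_std_basis[OF R] Ub zero tl)
  qed
  then have \<psi>\<phi>: "?\<psi> = ?\<phi>"
    using ex1_path_ops_rep[OF R G] function_rep_path_ops[OF R G] by blast
  show "\<pi> = transport_rep ?L M V U ?\<phi>"
  proof (rule extensionalityI[OF is_representationD(3)[OF \<pi>]])
    fix a assume a: "a \<in> carrier ?L"
    note End = is_representationD(4)[OF \<pi> a]
    show "\<pi> a = transport_rep ?L M V U ?\<phi> a"
      unfolding \<psi>\<phi>[symmetric]
      by (rule extensionalityI[OF mod_homD(2)[OF End]])
        (use a in \<open>auto simp: transport_rep_def mod_homD(3)[OF Uh] VU mod_homD(3)[OF End]\<close>)
  qed (simp add: transport_rep_def)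
qed

theorem proposition4p5:
  fixes R :: "('r, 'c) ring_scheme"
    and G :: "('v, 'e) ugraph"
    and M :: "('r, 'm, 'd) module_scheme"
    and b :: "('v, 'e) path \<Rightarrow> 'm"
  assumes "cring R"
    and "ultragraph G"
    and "free_module_with_basis R M (paths G) b"
  shows "equivalent_representations R (leavitt R G)
    M (basis_rep R G M b)
    (finsupp_module R (paths G)) (function_rep R G)"
proof -
  let ?L = "leavitt R G" and ?N = "finsupp_module R (paths G)" and ?\<phi> = "function_rep R G"
  note R = assms(1) and G = assms(2)
  have M: "module R M" and b: "b \<in> paths G \<rightarrow> carrier M"
    using assms(3) by (auto simp: free_module_with_basis_def)
  have N: "module R ?N" by (rule finsupp_module_is_module[OF R])
  define V where "V = lin_comb R M (paths G) b"
  define U where "U = (\<lambda>m\<in>carrier M. inv_into (carrier ?N) V m)"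
  have V: "V \<in> mod_iso R ?N M" unfolding V_def by (rule lin_comb_iso[OF assms(3)])
  note U = mod_iso_inverse[OF N V, folded U_def]
  have Vh: "V \<in> mod_hom R ?N M" and Uh: "U \<in> mod_hom R M ?N"
    using U V by (auto simp: mod_iso_def)
  have \<pi>: "basis_rep R G M b = transport_rep ?L M V U ?\<phi>"
    by (rule basis_rep_eq_transport[OF R G M V U(1)])
      (simp_all add: U(2,3), simp add: V_def lin_comb_std_basis[OF M b])
  have \<phi>: "is_representation R ?L ?N ?\<phi>"
    using function_rep_path_ops[OF R G] by (simp add: path_ops_rep_def)
  have "compose (carrier M) U (transport_rep ?L M V U ?\<phi> a) = compose (carrier M) (?\<phi> a) U"
    if a: "a \<in> carrier ?L" for a
    using a is_representationD(4)[OF \<phi> a, THEN mod_homD(3)]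
    by (auto simp: compose_def fun_eq_iff restrict_def transport_rep_def U(2) mod_homD(3)[OF Uh])
  moreover have "is_representation R ?L M (transport_rep ?L M V U ?\<phi>)"
    by (rule transport_rep_representation[OF leavitt_is_algebra[OF R] \<phi> M Vh Uh U(2)])
  ultimately show ?thesis
    unfolding equivalent_representations_def \<pi> using \<phi> U(1) by blast
qed

end
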